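(* Every permuton $\mu$ such that the function $F_\mu$ is piecewise polynomial is finitely forcible.
   Context: A permuton is a probability measure $\mu$ on the Borel sets of $[0,1]^2$ with uniform marginals, i.e., $\mu([\alpha,\beta]\times[0,1])=\mu([0,1]\times[\alpha,\beta])=\beta-\alpha$ for all $0\le\alpha\le\beta\le1$. $F_\mu:[0,1]^2\to[0,1]$ is $F_\mu(x,y)=\mu([0,x]\times[0,y])$. A function $f:[0,1]^2\to\mathbb{R}$ is piecewise polynomial if there are finitely many polynomials $p_1,\dots,p_k$ with $f(x,y)\in\{p_1(x,y),\dots,p_k(x,y)\}$ for every $(x,y)\in[0,1]^2$. A $\mu$-random permutation of order $n$ is obtained by sampling $n$ points independently according to $\mu$, ordering them by $x$-coordinate as $x_{i_1}<\dots<x_{i_n}$ and letting $\pi(j)<\pi(j')$ iff $y_{i_j}<y_{i_{j'}}$; $d(\sigma,\mu)$ is the probability that a $\mu$-random permutation of order $|\sigma|$ equals $\sigma$. A permuton $\mu$ is finitely forcible if there is a finite set $S$ of permutations such that every permuton $\mu'$ with $d(\sigma,\mu')=d(\sigma,\mu)$ for all $\sigma\in S$ equals $\mu$. *)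

theory Defs
  imports "HOL-Probability.Probability" "HOL-Combinatorics.Permutations"
begin

abbreviation unit_square :: "(real \<times> real) set" where
  "unit_square \<equiv> {0..1} \<times> {0..1}"

text \<open>
  The condition on \<^term>\<open>sets \<mu>\<close> also fixes the underlying space to be the unit square,
  so equality of permutons as elements of the measure type is equality of measures.
\<close>

definition permuton :: "(real \<times> real) measure \<Rightarrow> bool" where
  "permuton \<mu> \<longleftrightarrow>
     prob_space \<mu> \<and>
     sets \<mu> = sets (restrict_space borel unit_square) \<and>
     (\<forall>a b. 0 \<le> a \<and> a \<le> b \<and> b \<le> 1 \<longrightarrow>
        measure \<mu> ({a..b} \<times> {0..1}) = b - a \<and>
        measure \<mu> ({0..1} \<times> {a..b}) = b - a)"

definition permuton_cdf :: "(real \<times> real) measure \<Rightarrow> real \<times> real \<Rightarrow> real" where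
  "permuton_cdf \<mu> = (\<lambda>(x, y). measure \<mu> ({0..x} \<times> {0..y}))"

text \<open>
  On \<^typ>\<open>real \<times> real\<close>, the library predicate \<^const>\<open>real_polynomial_function\<close> describes
  exactly the functions given by real polynomials in the two coordinates.
\<close>

definition piecewise_polynomial :: "(real \<times> real \<Rightarrow> real) \<Rightarrow> bool" where
  "piecewise_polynomial f \<longleftrightarrow>
     (\<exists>P. finite P \<and> (\<forall>p\<in>P. real_polynomial_function p) \<and>
          (\<forall>z\<in>unit_square. f z \<in> {p z | p. p \<in> P}))"

text \<open>
  The points \<open>pt 1, \<dots>, pt n\<close> induce the permutation \<open>\<pi>\<close> of \<open>{1..n}\<close>: here \<open>\<iota> j\<close> is the index of
  the point with the \<open>j\<close>-th smallest first coordinate. Points with a coincidence among their first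
  or among their second coordinates induce no permutation; for points sampled independently from
  a permuton this happens with probability zero.
\<close>

definition induces_perm :: "nat \<Rightarrow> (nat \<Rightarrow> real \<times> real) \<Rightarrow> (nat \<Rightarrow> nat) \<Rightarrow> bool" where
  "induces_perm n pt \<pi> \<longleftrightarrow>
     (\<exists>\<iota>. bij_betw \<iota> {1..n} {1..n} \<and>
          strict_mono_on {1..n} (\<lambda>j. fst (pt (\<iota> j))) \<and>
          (\<forall>j\<in>{1..n}. \<forall>j'\<in>{1..n}. \<pi> j < \<pi> j' \<longleftrightarrow> snd (pt (\<iota> j)) < snd (pt (\<iota> j'))))"

text \<open>
  A permutation of order \<open>n\<close> is represented as a pair \<open>(n, \<pi>)\<close> with \<open>\<pi>\<close> permuting \<open>{1..n}\<close>; the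
  order is recorded explicitly since \<open>\<pi>\<close> alone does not determine it.
\<close>

definition finite_perms :: "(nat \<times> (nat \<Rightarrow> nat)) set" where
  "finite_perms = {(n, \<pi>). \<pi> permutes {1..n}}"

definition perm_density :: "nat \<times> (nat \<Rightarrow> nat) \<Rightarrow> (real \<times> real) measure \<Rightarrow> real" where
  "perm_density = (\<lambda>(n, \<pi>) \<mu>.
     let M = PiM {1..n} (\<lambda>_. \<mu>) in measure M {pt \<in> space M. induces_perm n pt \<pi>})"

definition finitely_forcible :: "(real \<times> real) measure \<Rightarrow> bool" where
  "finitely_forcible \<mu> \<longleftrightarrow>
     (\<exists>S. finite S \<and> S \<subseteq> finite_perms \<and>
          (\<forall>\<mu>'. permuton \<mu>' \<and> (\<forall>\<sigma>\<in>S. perm_density \<sigma> \<mu>' = perm_density \<sigma> \<mu>) \<longrightarrow> \<mu>' = \<mu>))"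

end

theory Submission
  imports Defs
begin

text \<open>
  Comparing points of a random sample with two further sample points, whose first and second
  coordinates play the role of \<open>x\<close> and \<open>y\<close>, shows that every integral
  \<open>\<integral> x^a y^b F(x, y)^c\<close> over the square is a linear combination of permutation densities of order
  \<open>a + b + c + 2\<close>. Hence finitely many densities force
  \<open>\<integral> (\<Prod>p\<in>P. F - p)^2 = 0\<close>, that is, \<open>F(z) \<in> {p(z) | p \<in> P}\<close> for all \<open>z\<close>.

  Only finitely many continuous functions \<open>F\<close> have this property. Let \<open>q(x, y)\<close> be a polynomial vanishing
  where two members of \<open>P\<close> coincide and for \<open>x \<in> {0, 1}\<close>. For all but finitely many \<open>y\<close> the roots of
  \<open>q(\<sqdot>, y)\<close> are simple roots of another polynomial \<open>h(\<sqdot>, y)\<close>. If two such functions agree on the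
  horizontal line at a good height \<open>y\<close>, they therefore agree on all nearby lines, and by connectedness
  on the whole strip between two consecutive bad heights. On a single line, agreement at one point
  between any two consecutive roots of \<open>q(\<sqdot>, y)\<close> suffices. So the values on a finite set of points
  determine \<open>F\<close>.

  The finitely many remaining permutons are told apart from \<open>\<mu>\<close> by integrals \<open>\<integral> r F\<close> with
  polynomials \<open>r\<close> close to the difference of the distribution functions.
\<close>

section \<open>Bivariate polynomials on horizontal lines\<close>

text \<open>A bivariate polynomial is regarded as a polynomial in \<open>x\<close> whose coefficients are polynomials in \<open>y\<close>.\<close>

definition fibre :: "real \<Rightarrow> real poly poly \<Rightarrow> real poly" where
  "fibre y q = map_poly (\<lambda>c. poly c y) q"

lemma coeff_fibre: "coeff (fibre y q) n = poly (coeff q n) y"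
  by (simp add: fibre_def coeff_map_poly)

lemma fibre_simps:
  "fibre y 0 = 0" "fibre y 1 = 1"
  "fibre y (p + q) = fibre y p + fibre y q"
  "fibre y (p - q) = fibre y p - fibre y q"
  "fibre y (p * q) = fibre y p * fibre y q"
  "fibre y (smult c q) = smult (poly c y) (fibre y q)"
  "fibre y (pderiv q) = pderiv (fibre y q)"
  "fibre y (pCons c q) = pCons (poly c y) (fibre y q)"
  by (auto simp: poly_eq_iff coeff_fibre coeff_mult poly_sum coeff_pderiv coeff_pCons
      simp del: mult_pCons_left split: nat.split)

lemma fibre_prod: "fibre y (prod f A) = (\<Prod>a\<in>A. fibre y (f a))"
  by (induction A rule: infinite_finite_induct) (simp_all add: fibre_simps)

text \<open>A fibre vanishes only where every coefficient does, in particular the nonzero leading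
  one.\<close>

lemma fibre_eq_0_finite:
  assumes "q \<noteq> 0"
  shows "finite {y. fibre y q = 0}"
proof (rule finite_subset)
  show "{y. fibre y q = 0} \<subseteq> {y. poly (lead_coeff q) y = 0}"
    by (auto simp flip: coeff_fibre)
  show "finite {y. poly (lead_coeff q) y = 0}"
    using assms by (intro poly_roots_finite) simp
qed

lemma continuous_on_poly_fibre [continuous_intros]:
  fixes f g :: "'a::topological_space \<Rightarrow> real"
  assumes "continuous_on S f" "continuous_on S g"
  shows "continuous_on S (\<lambda>z. poly (fibre (g z) q) (f z))"
  by (induction q) (use assms in \<open>auto simp: fibre_simps intro!: continuous_intros\<close>)

text \<open>Replaces the inductive predicate by an iterated polynomial, for which degrees, division
  and the derivative in \<open>x\<close> are at hand.\<close>

lemma real_polynomial_function_fibre: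
  fixes p :: "real \<times> real \<Rightarrow> real"
  assumes "real_polynomial_function p"
  shows "\<exists>q. \<forall>x y. p (x, y) = poly (fibre y q) x"
  using assms
proof induction
  case (linear f)
  have "f (x, y) = poly (fibre y [:[:0, f (0, 1):], [:f (1, 0):]:]) x" for x y
  proof -
    have "(x, y) = x *\<^sub>R (1, 0) + y *\<^sub>R (0, 1)" by simp
    then have "f (x, y) = x *\<^sub>R f (1, 0) + y *\<^sub>R f (0, 1)"
      using bounded_linear.linear[OF linear] by (simp only: linear_add linear_cmul)
    then show ?thesis by (simp add: fibre_simps)
  qed
  then show ?case by blast
next
  case (const c)
  have "c = poly (fibre y [:[:c:]:]) x" for x y by (simp add: fibre_simps)
  then show ?case by blast
next
  case (add f g)
  then obtain q r where "\<forall>x y. f (x, y) = poly (fibre y q) x" "\<forall>x y. g (x, y) = poly (fibre y r) x"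
    by blast
  then have "\<forall>x y. f (x, y) + g (x, y) = poly (fibre y (q + r)) x" by (simp add: fibre_simps)
  then show ?case by blast
next
  case (mult f g)
  then obtain q r where "\<forall>x y. f (x, y) = poly (fibre y q) x" "\<forall>x y. g (x, y) = poly (fibre y r) x"
    by blast
  then have "\<forall>x y. f (x, y) * g (x, y) = poly (fibre y (q * r)) x" by (simp add: fibre_simps)
  then show ?case by blast
qed

text \<open>The Euclidean algorithm over the fraction field, with the denominators cleared by a
  nonzero constant \<open>s\<close>.\<close>

lemma pseudo_bezout:
  fixes a b :: "'a::idom poly"
  shows "\<exists>s g u v a1 b1. s \<noteq> 0 \<and> smult s g = u * a + v * b \<and> smult s a = g * a1 \<and> smult s b = g * b1"
\<comment> \<open>The measure separates \<open>b = 0\<close> from the nonzero constants, which have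
  the same degree.\<close>
proof (induction "if b = 0 then 0 else Suc (degree b)" arbitrary: a b rule: less_induct)
  case less
  show ?case
  proof (cases "b = 0")
    case True
    have "(1::'a) \<noteq> 0 \<and> smult 1 a = 1 * a + 0 * b \<and> smult 1 a = a * 1 \<and> smult 1 b = a * 0"
      using True by simp
    then show ?thesis by blast
  next
    case False
    define r where "r = pseudo_mod a b"
    obtain c q where c: "c \<noteq> 0" "smult c a = b * q + r"
      using pseudo_mod(1)[OF False, of a] by (auto simp: r_def)
    have "r = 0 \<or> degree r < degree b"
      using pseudo_mod(2)[OF False, of a] by (auto simp: r_def)
    then have "(if r = 0 then 0 else Suc (degree r)) < (if b = 0 then 0 else Suc (degree b))"
      using False by auto
    from less[OF this, of b] obtain s g u v b1 r1 where
      s: "s \<noteq> 0" and g: "smult s g = u * b + v * r" "smult s b = g * b1" "smult s r = g * r1"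
      by (elim exE conjE)
    \<comment> \<open>Eliminating the remainder turns the identity for \<open>b\<close> and
      \<open>r\<close> into one for \<open>a\<close> and \<open>b\<close>; all three relations are
      scaled to the common constant \<open>s * c\<close>.\<close>
    have r: "r = smult c a - b * q" using c by simp
    have "smult (s * c) g = smult c (smult s g)" by (simp add: mult.commute)
    also have "\<dots> = smult (c * c) v * a + smult c (u - v * q) * b"
      unfolding g r by (simp add: algebra_simps smult_add_right smult_diff_right)
    finally have 1: "smult (s * c) g = smult (c * c) v * a + smult c (u - v * q) * b" .
    have "smult (s * c) a = smult s (smult c a)" by simp
    also have "\<dots> = smult s b * q + smult s r" unfolding c by (simp add: smult_add_right)
    also have "\<dots> = g * (b1 * q + r1)" unfolding g by (simp add: algebra_simps)
    finally have 2: "smult (s * c) a = g * (b1 * q + r1)" .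
    have "smult (s * c) b = smult c (smult s b)" by (simp add: mult.commute)
    also have "\<dots> = g * smult c b1" unfolding g by simp
    finally have 3: "smult (s * c) b = g * smult c b1" .
    show ?thesis
      by (intro exI[of _ "s * c"] exI conjI, use c s in simp) (rule 1 2 3)+
  qed
qed

text \<open>Dividing \<open>q\<close> by its greatest common divisor with \<open>\<partial>q/\<partial>x\<close> leaves a polynomial that is
  squarefree on almost every fibre and has the same roots there.\<close>

lemma squarefree_fibres:
  fixes q :: "real poly poly"
  assumes "q \<noteq> 0"
  shows "\<exists>h Y. finite Y \<and> (\<forall>y. y \<notin> Y \<longrightarrow> fibre y q \<noteq> 0 \<and>
     (\<forall>x. poly (fibre y q) x = 0 \<longrightarrow>
        poly (fibre y h) x = 0 \<and> poly (pderiv (fibre y h)) x \<noteq> 0))"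
proof -
  obtain s g u v h d where s: "s \<noteq> 0" and g: "smult s g = u * q + v * pderiv q"
      "smult s q = g * h" "smult s (pderiv q) = g * d"
    using pseudo_bezout[of q "pderiv q"] by metis
  \<comment> \<open>Off \<open>Y\<close> the constant \<open>s\<close> can be divided out and the
    fibre of \<open>q\<close> is not the zero polynomial.\<close>
  define Y where "Y = {y. poly s y = 0} \<union> {y. fibre y q = 0}"
  have fin: "finite Y"
    unfolding Y_def using s assms by (auto intro: poly_roots_finite fibre_eq_0_finite)
  have "poly (fibre y h) x = 0 \<and> poly (pderiv (fibre y h)) x \<noteq> 0"
    if y: "y \<notin> Y" and x: "poly (fibre y q) x = 0" for x y
  proof -
    define t where "t = poly s y"
    have t: "t \<noteq> 0" and nz: "fibre y q \<noteq> 0" using y by (auto simp: Y_def t_def)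
    have e: "smult t (fibre y g) = fibre y u * fibre y q + fibre y v * pderiv (fibre y q)"
      "smult t (fibre y q) = fibre y g * fibre y h"
      "smult t (pderiv (fibre y q)) = fibre y g * fibre y d"
      using g[THEN arg_cong[of _ _ "fibre y"]] by (simp_all add: fibre_simps t_def)
    have inv: "A = smult (inverse t) B" if "smult t A = B" for A B :: "real poly"
      using that t by auto
    \<comment> \<open>A constant fibre with a root would be zero.\<close>
    have "pderiv (fibre y q) \<noteq> 0"
    proof
      assume "pderiv (fibre y q) = 0"
      then obtain c where c: "fibre y q = [:c:]" using pderiv_iszero by blast
      then show False using x nz by auto
    qed
    moreover have "fibre y q = smult (inverse t) (fibre y h) * fibre y g"
      using inv[OF e(2)] by (simp add: mult.commute)
    moreover have "pderiv (fibre y q) = smult (inverse t) (fibre y d) * fibre y g"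
      using inv[OF e(3)] by (simp add: mult.commute)
    moreover have "fibre y g = smult (inverse t) (fibre y u) * fibre y q
        + smult (inverse t) (fibre y v) * pderiv (fibre y q)"
      using inv[OF e(1)] by (simp add: smult_add_right)
    \<comment> \<open>After division by \<open>t\<close> the relations hold over the field of reals:
      up to a constant, the fibre of \<open>h\<close> is the quotient of that of \<open>q\<close> by
      a greatest common divisor with its derivative.\<close>
    ultimately have "rsquarefree (smult (inverse t) (fibre y h)) \<and>
      (\<forall>a. poly (smult (inverse t) (fibre y h)) a = 0 \<longleftrightarrow> poly (fibre y q) a = 0)"
      by (rule poly_squarefree_decomp)
    then show ?thesis using t x by (auto simp: rsquarefree_roots pderiv_smult)
  qed
  then show ?thesis using fin by (intro exI[of _ h] exI[of _ Y]) (auto simp: Y_def)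
qed

section \<open>Continuous selections from finitely many polynomials\<close>

text \<open>The sets where a selection equals a given member of \<open>P\<close> are closed, cover
  \<open>S\<close>, and are disjoint because the members have distinct values; connectedness leaves
  a single one. So two selections that meet at one point follow the same member.\<close>

lemma selections_eq_on_connected:
  fixes F G :: "'a::topological_space \<Rightarrow> real"
  assumes "finite P" "connected S" "continuous_on S F" "continuous_on S G"
    and "\<And>p. p \<in> P \<Longrightarrow> continuous_on S p"
    and "\<And>z. z \<in> S \<Longrightarrow> F z \<in> (\<lambda>p. p z) ` P" "\<And>z. z \<in> S \<Longrightarrow> G z \<in> (\<lambda>p. p z) ` P"
    and inj: "\<And>z. z \<in> S \<Longrightarrow> inj_on (\<lambda>p. p z) P"
    and z0: "z0 \<in> S" "F z0 = G z0" and z: "z \<in> S"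
  shows "F z = G z"
proof -
  obtain p where p: "p \<in> P" "F z0 = p z0" using assms(6)[OF z0(1)] by auto
  have "H z = p z"
    if H: "continuous_on S H" "\<And>z. z \<in> S \<Longrightarrow> H z \<in> (\<lambda>p. p z) ` P" "H z0 = p z0" for H
  proof (rule ccontr)
    assume ne: "H z \<noteq> p z"
    define E where "E = (\<lambda>r. {z \<in> S. H z - r z = 0})"
    have cl: "closedin (top_of_set S) (E r)" if "r \<in> P" for r
      unfolding E_def using that H(1) assms(5)
      by (intro continuous_closedin_preimage_constant continuous_intros) auto
    have "closedin (top_of_set S) (\<Union>r\<in>P - {p}. E r)"
      using assms(1) cl by (intro closedin_Union) auto
    moreover have "S \<subseteq> E p \<union> (\<Union>r\<in>P - {p}. E r)"
      using H(2) by (force simp: E_def)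
    moreover have "E p \<inter> (\<Union>r\<in>P - {p}. E r) = {}"
      using inj p(1) by (auto simp: E_def inj_on_def)
    moreover have "E p \<noteq> {}" using z0 H(3) by (auto simp: E_def)
    moreover have "(\<Union>r\<in>P - {p}. E r) \<noteq> {}" using z ne H(2)[OF z] by (force simp: E_def)
    ultimately show False
      using assms(2) cl[OF p(1)] unfolding connected_closedin by blast
  qed
  from this[of F] this[of G] show ?thesis using assms p z0 by simp
qed

lemma finite_set_gap:
  fixes y :: "'a::linorder"
  assumes "finite Y" "a \<in> Y" "b \<in> Y" "a < y" "y < b" "y \<notin> Y"
  obtains c d where "c \<in> Y" "d \<in> Y" "a \<le> c" "c < y" "y < d" "d \<le> b" "{c<..<d} \<inter> Y = {}"
proof
  let ?L = "{t \<in> Y. t < y}" and ?U = "{t \<in> Y. y < t}"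
  have L: "finite ?L" "?L \<noteq> {}" and U: "finite ?U" "?U \<noteq> {}" using assms by auto
  show "Max ?L \<in> Y" "Max ?L < y" "Min ?U \<in> Y" "y < Min ?U"
    using Max_in[OF L] Min_in[OF U] by auto
  show "a \<le> Max ?L" "Min ?U \<le> b" using assms by auto
  show "{Max ?L<..<Min ?U} \<inter> Y = {}"
  proof -
    have False if "t \<in> Y" "Max ?L < t" "t < Min ?U" for t
    proof (cases "t < y")
      case True
      then have "t \<le> Max ?L" using that L by (intro Max_ge) auto
      then show False using that by simp
    next
      case False
      then have "y < t" using that assms(6) by (metis not_less_iff_gr_or_eq)
      then have "Min ?U \<le> t" using that U by (intro Min_le) auto
      then show False using that by simp
    qed
    then show ?thesis by auto
  qed
qed

text \<open>No point of a nondegenerate interval is isolated, so a difference at one point would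
  spread to points outside \<open>X\<close>.\<close>

lemma continuous_eq_off_finite:
  fixes f g :: "real \<Rightarrow> real"
  assumes "continuous_on {a..b} f" "continuous_on {a..b} g" "a < b" "finite X"
    and eq: "\<And>x. x \<in> {a..b} \<Longrightarrow> x \<notin> X \<Longrightarrow> f x = g x" and x: "x \<in> {a..b}"
  shows "f x = g x"
proof (rule ccontr)
  assume ne: "f x \<noteq> g x"
  have "openin (top_of_set {a..b}) ({a..b} \<inter> (\<lambda>t. f t - g t) -` (- {0}))"
    using assms by (intro continuous_openin_preimage_gen continuous_intros) auto
  then obtain T where "open T" and T': "{a..b} \<inter> (\<lambda>t. f t - g t) -` (- {0}) = {a..b} \<inter> T"
    unfolding openin_open by blast
  have T: "t \<in> T \<longleftrightarrow> f t \<noteq> g t" if "t \<in> {a..b}" for t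
    using T'[THEN arg_cong, of "\<lambda>A. t \<in> A"] that by simp
  \<comment> \<open>Deleting the other points of \<open>X\<close> keeps an open neighbourhood of
    \<open>x\<close>, so the nearby point found in it lies outside \<open>X\<close>.\<close>
  have o: "open (T \<inter> - (X - {x}))"
    using \<open>open T\<close> assms(4) by (intro open_Int open_Compl finite_imp_closed) auto
  have i: "x \<in> T \<inter> - (X - {x})" using T[OF x] ne by simp
  have "x islimpt {a..b}" using x assms(3) by (simp add: islimpt_Icc)
  from islimptE[OF this i o] obtain t where "t \<in> {a..b}" "t \<in> T \<inter> - (X - {x})" "t \<noteq> x"
    by metis
  then show False using T[of t] eq[of t] by auto
qed

lemma nonzero_near:
  fixes f :: "real \<Rightarrow> real \<Rightarrow> real"
  assumes "continuous_on UNIV (\<lambda>z. f (fst z) (snd z))" "f x1 y1 \<noteq> 0"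
  obtains d where "d > 0" "\<And>x y. \<bar>x - x1\<bar> \<le> d \<Longrightarrow> \<bar>y - y1\<bar> \<le> d \<Longrightarrow> f x y \<noteq> 0"
proof -
  have "open ((\<lambda>z. f (fst z) (snd z)) -` (- {0}))"
    using assms(1) by (intro open_vimage) auto
  moreover have "(x1, y1) \<in> (\<lambda>z. f (fst z) (snd z)) -` (- {0})" using assms(2) by simp
  ultimately obtain e where e: "e > 0" "ball (x1, y1) e \<subseteq> (\<lambda>z. f (fst z) (snd z)) -` (- {0})"
    by (meson openE)
  show ?thesis
  \<comment> \<open>Each coordinate contributes at most \<open>e / 4\<close>, so the Euclidean
    distance is at most \<open>e / 2\<close>.\<close>
  proof (rule that[of "e / 4"])
    fix x y assume "\<bar>x - x1\<bar> \<le> e / 4" "\<bar>y - y1\<bar> \<le> e / 4"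
    moreover have "dist (x1, y1) (x, y) \<le> \<bar>x - x1\<bar> + \<bar>y - y1\<bar>"
      unfolding dist_Pair_Pair
      using sqrt_sum_squares_le_sum_abs[of "dist x1 x" "dist y1 y"] by (simp add: dist_real_def abs_minus_commute)
    ultimately have "(x, y) \<in> ball (x1, y1) e" using e by auto
    then show "f x y \<noteq> 0" using e by auto
  qed (use e in simp)
qed

text \<open>Pointwise choices as in \<open>piecewise_polynomial\<close>, with continuity added
  because it ties neighbouring choices together.\<close>

definition selection :: "('a::topological_space \<Rightarrow> real) set \<Rightarrow> 'a set \<Rightarrow> ('a \<Rightarrow> real) \<Rightarrow> bool" where
  "selection P S F \<longleftrightarrow> continuous_on S F \<and> (\<forall>z\<in>S. F z \<in> (\<lambda>p. p z) ` P)"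

section \<open>Comparing two selections on lines and strips\<close>

text \<open>Standing data: off the zero set of \<open>q\<close> the members of \<open>P\<close> have
  distinct values, \<open>Y\<close> collects the bad heights, and at good heights each root of
  \<open>q\<close> is a simple root of \<open>h\<close>. The roots \<open>0\<close> and
  \<open>1\<close> bound the outermost gaps on every horizontal line.\<close>

context
  fixes P :: "(real \<times> real \<Rightarrow> real) set" and q h :: "real poly poly" and Y :: "real set"
  assumes finP: "finite P" and contP: "\<And>p. p \<in> P \<Longrightarrow> continuous_on UNIV p"
    and inj: "\<And>x y. poly (fibre y q) x \<noteq> 0 \<Longrightarrow> inj_on (\<lambda>p. p (x, y)) P"
    and finY: "finite Y"
    and nz: "\<And>y. y \<notin> Y \<Longrightarrow> fibre y q \<noteq> 0"
    and root: "\<And>x y. y \<notin> Y \<Longrightarrow> poly (fibre y q) x = 0 \<Longrightarrow>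
        poly (fibre y h) x = 0 \<and> poly (pderiv (fibre y h)) x \<noteq> 0"
    and ends: "\<And>y. poly (fibre y q) 0 = 0" "\<And>y. poly (fibre y q) 1 = 0"
begin

lemma selections_eq_on_connected':
  assumes "selection P unit_square F" "selection P unit_square G" "connected S" "S \<subseteq> unit_square"
    and "\<And>x y. (x, y) \<in> S \<Longrightarrow> poly (fibre y q) x \<noteq> 0"
    and "z0 \<in> S" "F z0 = G z0" "z \<in> S"
  shows "F z = G z"
proof (rule selections_eq_on_connected[OF finP assms(3), of F G z0])
  show "continuous_on S F" "continuous_on S G"
    using assms(1,2,4) by (auto simp: selection_def intro: continuous_on_subset)
  show "continuous_on S p" if "p \<in> P" for p using contP[OF that] continuous_on_subset by blast
  show "F z \<in> (\<lambda>p. p z) ` P" "G z \<in> (\<lambda>p. p z) ` P" if "z \<in> S" for z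
    using assms(1,2,4) that unfolding selection_def by blast+
  show "inj_on (\<lambda>p. p z) P" if "z \<in> S" for z
    using inj assms(5) that by (cases z) blast
qed (use assms in blast)+

context
  fixes F G
  assumes F: "selection P unit_square F" and G: "selection P unit_square G"
begin

lemma eq_on_segment:
  assumes "connected I" "I \<subseteq> {0..1}" "y \<in> {0..1}" "\<forall>t\<in>I. poly (fibre y q) t \<noteq> 0"
    and "F (a, y) = G (a, y)" "a \<in> I" "x \<in> I"
  shows "F (x, y) = G (x, y)"
proof (rule selections_eq_on_connected'[OF F G, of "I \<times> {y}" "(a, y)"])
  show "connected (I \<times> {y})" using assms(1) by (intro connected_Times) auto
qed (use assms in auto)

text \<open>A box around the point, cut down to the square, avoids the zeros of \<open>q\<close> and
  is convex, hence connected.\<close>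

lemma eq_near_regular:
  assumes "x1 \<in> {0..1}" "y1 \<in> {0..1}" "F (x1, y1) = G (x1, y1)" "poly (fibre y1 q) x1 \<noteq> 0"
  obtains d where "d > 0" "\<And>x y. (x, y) \<in> unit_square \<Longrightarrow> \<bar>x - x1\<bar> < d \<Longrightarrow> \<bar>y - y1\<bar> < d \<Longrightarrow> F (x, y) = G (x, y)"
proof -
  obtain d where d: "d > 0" "\<And>x y. \<bar>x - x1\<bar> \<le> d \<Longrightarrow> \<bar>y - y1\<bar> \<le> d \<Longrightarrow> poly (fibre y q) x \<noteq> 0"
    by (rule nonzero_near[of "\<lambda>x y. poly (fibre y q) x" x1 y1])
       (use assms in \<open>auto intro!: continuous_intros\<close>)
  define S where "S = ({x1-d<..<x1+d} \<inter> {0..1}) \<times> ({y1-d<..<y1+d} \<inter> {0..1})"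
  have "connected S" unfolding S_def
    by (intro convex_connected convex_Times convex_Int) auto
  moreover have "S \<subseteq> unit_square" "(x1, y1) \<in> S" using assms(1,2) d(1) by (auto simp: S_def)
  moreover have "poly (fibre y q) x \<noteq> 0" if "(x, y) \<in> S" for x y
    using that by (intro d(2)) (auto simp: S_def)
  ultimately have *: "F z = G z" if "z \<in> S" for z
    using selections_eq_on_connected'[OF F G, of S "(x1, y1)" z] assms(3) that by blast
  then have "F (x, y) = G (x, y)"
    if "(x, y) \<in> unit_square" "\<bar>x - x1\<bar> < d" "\<bar>y - y1\<bar> < d" for x y
    using that by (intro *) (auto simp: S_def)
  with d(1) show ?thesis by (rule that)
qed

text \<open>Over a good \<open>y\<close> the polynomial \<open>h(\<sqdot>, y)\<close> has a single simple root near a root of \<open>q(\<sqdot>, y1)\<close>,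
  so any point close to it is joined on its horizontal line, avoiding the root, to one of the two ends
  of a short interval, where the selections are known to agree.\<close>

lemma eq_near_line:
  assumes x1: "x1 \<in> {0..1}" and y1: "y1 \<in> {0..1}" "y1 \<notin> Y"
    and eq: "\<And>x. x \<in> {0..1} \<Longrightarrow> F (x, y1) = G (x, y1)"
  obtains d where "d > 0"
    "\<And>x y. (x, y) \<in> unit_square \<Longrightarrow> \<bar>x - x1\<bar> < d \<Longrightarrow> \<bar>y - y1\<bar> < d \<Longrightarrow>
       poly (fibre y q) x \<noteq> 0 \<Longrightarrow> F (x, y) = G (x, y)"
proof (cases "poly (fibre y1 q) x1 = 0")
  case False
  from eq_near_regular[OF x1 y1(1) eq[OF x1] False] that show ?thesis by metis
next
  case True
  then have h: "poly (fibre y1 h) x1 = 0" "poly (pderiv (fibre y1 h)) x1 \<noteq> 0"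
    using root[OF y1(2)] by auto
  obtain e where e: "e > 0"
    "\<And>x y. \<bar>x - x1\<bar> \<le> e \<Longrightarrow> \<bar>y - y1\<bar> \<le> e \<Longrightarrow> poly (pderiv (fibre y h)) x \<noteq> 0"
    by (rule nonzero_near[of "\<lambda>x y. poly (pderiv (fibre y h)) x" x1 y1])
       (use h in \<open>auto intro!: continuous_intros simp flip: fibre_simps\<close>)
  \<comment> \<open>The ends \<open>x1 - d\<close> and \<open>x1 + d\<close> stay in the unit
    interval unless \<open>x1\<close> is itself its left or right end; in that case the default
    \<open>1\<close> imposes nothing but positivity.\<close>
  define d where "d = Min {e, if x1 > 0 then x1 else 1, if x1 < 1 then 1 - x1 else 1}"
  have d: "d > 0" "d \<le> e" "x1 > 0 \<Longrightarrow> d \<le> x1" "x1 < 1 \<Longrightarrow> d \<le> 1 - x1"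
    using e x1 by (auto simp: d_def)
  \<comment> \<open>By the mean value theorem, two roots of \<open>h\<close> on one line would
    enclose a zero of its derivative, which \<open>e\<close> excludes.\<close>
  have uniq: "s = t" if "\<bar>y - y1\<bar> \<le> d" "s \<in> {x1-d..x1+d}" "t \<in> {x1-d..x1+d}"
    "poly (fibre y h) s = 0" "poly (fibre y h) t = 0" for s t y
  proof -
    have "False" if lt: "s < t" and "s \<in> {x1-d..x1+d}" "t \<in> {x1-d..x1+d}"
      "poly (fibre y h) s = 0" "poly (fibre y h) t = 0" for s t
    proof -
      obtain u where "s < u" "u < t" "poly (fibre y h) t - poly (fibre y h) s = (t - s) * poly (pderiv (fibre y h)) u"
        using poly_MVT[OF lt] by auto
      moreover have "poly (pderiv (fibre y h)) u \<noteq> 0"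
        using e(2)[of u y] \<open>\<bar>y - y1\<bar> \<le> d\<close> d(2) that \<open>s < u\<close> \<open>u < t\<close> by auto
      ultimately show False using that by auto
    qed
    then show ?thesis using that by (metis linorder_neqE)
  qed
  \<comment> \<open>At height \<open>y1\<close> the only root of \<open>h\<close> in the interval is
    \<open>x1\<close>, so its two ends are regular points and agreement extends from them to nearby
    heights.\<close>
  have side: "\<exists>c>0. \<forall>y\<in>{0..1}. \<bar>y - y1\<bar> < c \<longrightarrow> F (x, y) = G (x, y)"
    if "x \<in> {0..1}" "x = x1 - d \<or> x = x1 + d" for x
  proof -
    have "poly (fibre y1 h) x \<noteq> 0"
      using uniq[of y1 x x1] h(1) that d(1) by auto
    then have "poly (fibre y1 q) x \<noteq> 0" using root[OF y1(2)] by blast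
    from eq_near_regular[OF that(1) y1(1) eq[OF that(1)] this] obtain c where "c > 0"
      "\<And>x' y. (x', y) \<in> unit_square \<Longrightarrow> \<bar>x' - x\<bar> < c \<Longrightarrow> \<bar>y - y1\<bar> < c \<Longrightarrow> F (x', y) = G (x', y)"
      by metis
    then show ?thesis using that(1) by (intro exI[of _ c]) auto
  qed
  \<comment> \<open>The premise on \<open>x1\<close> sits inside the formula so that a radius exists
    even when this end lies outside the square.\<close>
  have "\<exists>c>0. \<forall>y\<in>{0..1}. \<bar>y - y1\<bar> < c \<longrightarrow>
      (x1 > 0 \<longrightarrow> F (x1 - d, y) = G (x1 - d, y))"
    using side[of "x1 - d"] d x1 by (cases "x1 > 0") (auto intro: exI[of _ 1])
  then obtain c1 where c1: "c1 > 0" "\<And>y. y \<in> {0..1} \<Longrightarrow> \<bar>y - y1\<bar> < c1 \<Longrightarrow> x1 > 0 \<Longrightarrow>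
      F (x1 - d, y) = G (x1 - d, y)" by blast
  have "\<exists>c>0. \<forall>y\<in>{0..1}. \<bar>y - y1\<bar> < c \<longrightarrow>
      (x1 < 1 \<longrightarrow> F (x1 + d, y) = G (x1 + d, y))"
    using side[of "x1 + d"] d x1 by (cases "x1 < 1") (auto intro: exI[of _ 1])
  then obtain c2 where c2: "c2 > 0" "\<And>y. y \<in> {0..1} \<Longrightarrow> \<bar>y - y1\<bar> < c2 \<Longrightarrow> x1 < 1 \<Longrightarrow>
      F (x1 + d, y) = G (x1 + d, y)" by blast
  \<comment> \<open>Nearby heights are still good, so \<open>root\<close> applies to them.\<close>
  obtain c3 where c3: "c3 > 0" "\<And>y. \<bar>y - y1\<bar> < c3 \<Longrightarrow> y \<notin> Y"
  proof -
    have "open (- Y)" using finY by (simp add: finite_imp_closed open_Compl)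
    then obtain c where "c > 0" "ball y1 c \<subseteq> - Y" using y1(2) by (meson ComplI openE)
    then show ?thesis using that[of c] by (auto simp: dist_real_def subset_iff abs_minus_commute)
  qed
  show ?thesis
  proof (rule that[of "Min {c1, c2, c3, d}"])
    fix x y assume xy: "(x, y) \<in> unit_square" and "\<bar>x - x1\<bar> < Min {c1, c2, c3, d}"
      "\<bar>y - y1\<bar> < Min {c1, c2, c3, d}" and Q: "poly (fibre y q) x \<noteq> 0"
    then have x: "\<bar>x - x1\<bar> < d" and y: "\<bar>y - y1\<bar> < c1" "\<bar>y - y1\<bar> < c2" "\<bar>y - y1\<bar> < d" "y \<notin> Y"
      using c3 by auto
    \<comment> \<open>Roots of \<open>q\<close> on both sides of \<open>x\<close> would be roots of
      \<open>h\<close> in the short interval, hence equal to each other and to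
      \<open>x\<close>.\<close>
    have "(\<forall>t\<in>{x1-d..x}. poly (fibre y q) t \<noteq> 0) \<or> (\<forall>t\<in>{x..x1+d}. poly (fibre y q) t \<noteq> 0)"
    proof (rule ccontr)
      assume "\<not> ?thesis"
      then obtain s t where st: "s \<in> {x1-d..x}" "t \<in> {x..x1+d}"
        "poly (fibre y q) s = 0" "poly (fibre y q) t = 0" by blast
      then have "s = t" using uniq[of y s t] root[OF y(4)] x y(3) by auto
      then show False using st Q by auto
    qed
    then show "F (x, y) = G (x, y)"
    proof
      assume z: "\<forall>t\<in>{x1-d..x}. poly (fibre y q) t \<noteq> 0"
      \<comment> \<open>Since \<open>0\<close> is a root of \<open>q\<close>, a root-free segment
        reaching to the left of \<open>x1\<close> shows that \<open>x1\<close> is not the left end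
        of the square.\<close>
      have "0 \<notin> {x1-d..x}" using z ends(1)[of y] by blast
      then have pos: "x1 > 0" using x1 d(1) xy by auto
      have eq: "F (x1 - d, y) = G (x1 - d, y)" using c1(2)[of y] xy y(1) pos by simp
      show ?thesis
        by (rule eq_on_segment[of "{x1-d..x}" y, OF _ _ _ _ eq])
          (use z xy x d(1) d(3)[OF pos] in auto)
    next
      assume z: "\<forall>t\<in>{x..x1+d}. poly (fibre y q) t \<noteq> 0"
      have "1 \<notin> {x..x1+d}" using z ends(2)[of y] by blast
      then have lt: "x1 < 1" using x1 d(1) xy by auto
      have eq: "F (x1 + d, y) = G (x1 + d, y)" using c2(2)[of y] xy y(2) lt by simp
      show ?thesis
        by (rule eq_on_segment[of "{x..x1+d}" y, OF _ _ _ _ eq])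
          (use z xy x d(1) d(4)[OF lt] in auto)
    qed
  qed (use c1 c2 c3 d in auto)
qed

lemma continuous_on_section:
  assumes "selection P unit_square H"
  shows "y \<in> {0..1} \<Longrightarrow> continuous_on {0..1} (\<lambda>x. H (x, y))"
    and "x \<in> {0..1} \<Longrightarrow> continuous_on {0..1} (\<lambda>y. H (x, y))"
proof -
  have H: "continuous_on unit_square H" using assms by (simp add: selection_def)
  show "continuous_on {0..1} (\<lambda>x. H (x, y))" if "y \<in> {0..1}"
    by (rule continuous_on_compose2[OF H]) (use that in \<open>auto intro!: continuous_intros\<close>)
  show "continuous_on {0..1} (\<lambda>y. H (x, y))" if "x \<in> {0..1}"
    by (rule continuous_on_compose2[OF H]) (use that in \<open>auto intro!: continuous_intros\<close>)
qed

text \<open>On a good line \<open>q\<close> has only finitely many roots, and continuity fills them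
  in.\<close>

lemma eq_on_line:
  assumes y: "y \<in> {0..1}" "y \<notin> Y"
    and eq: "\<And>x. x \<in> {0..1} \<Longrightarrow> poly (fibre y q) x \<noteq> 0 \<Longrightarrow> F (x, y) = G (x, y)"
    and x: "x \<in> {0..1}"
  shows "F (x, y) = G (x, y)"
  by (rule continuous_eq_off_finite[of 0 1 "\<lambda>x. F (x, y)" "\<lambda>x. G (x, y)" "{x. poly (fibre y q) x = 0}"])
     (use assms in \<open>auto intro!: continuous_on_section F G poly_roots_finite nz\<close>)

text \<open>Compactness of the horizontal segment turns the radii around its points into a single
  one; the roots of \<open>q\<close> left out locally are recovered on each good line.\<close>

lemma eq_on_near_lines:
  assumes y1: "y1 \<in> {0..1}" "y1 \<notin> Y"
    and eq: "\<And>x. x \<in> {0..1} \<Longrightarrow> F (x, y1) = G (x, y1)"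
  shows "\<exists>d>0. \<forall>y\<in>{0..1}. \<bar>y - y1\<bar> < d \<longrightarrow> y \<notin> Y \<longrightarrow> (\<forall>x\<in>{0..1}. F (x, y) = G (x, y))"
proof -
  have "\<exists>d>0. \<forall>x y. (x, y) \<in> unit_square \<longrightarrow> \<bar>x - x1\<bar> < d \<longrightarrow> \<bar>y - y1\<bar> < d \<longrightarrow>
       poly (fibre y q) x \<noteq> 0 \<longrightarrow> F (x, y) = G (x, y)" if "x1 \<in> {0..1}" for x1
    using eq_near_line[OF that y1 eq] by metis
  then obtain d where d: "\<And>x1. x1 \<in> {0..1} \<Longrightarrow> d x1 > 0"
    "\<And>x1 x y. x1 \<in> {0..1} \<Longrightarrow> (x, y) \<in> unit_square \<Longrightarrow> \<bar>x - x1\<bar> < d x1 \<Longrightarrow> \<bar>y - y1\<bar> < d x1 \<Longrightarrow>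
       poly (fibre y q) x \<noteq> 0 \<Longrightarrow> F (x, y) = G (x, y)"
    by metis
  obtain C where C: "C \<subseteq> {0..1}" "finite C" "{0..1} \<subseteq> (\<Union>c\<in>C. ball c (d c))"
  proof (rule compactE_image[of "{0..1::real}" "{0..1}" "\<lambda>c. ball c (d c)"])
    show "{0..1} \<subseteq> (\<Union>c\<in>{0..1}. ball c (d c))"
      using d(1) centre_in_ball by blast
  qed auto
  have "\<forall>x\<in>{0..1}. F (x, y) = G (x, y)"
    if y: "y \<in> {0..1}" "\<bar>y - y1\<bar> < Min (d ` C)" "y \<notin> Y" for y
  proof
    fix x :: real assume x: "x \<in> {0..1}"
    show "F (x, y) = G (x, y)"
    proof (rule eq_on_line[OF y(1,3) _ x])
      fix x assume x: "x \<in> {0..1}" "poly (fibre y q) x \<noteq> 0"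
      then obtain c where c: "c \<in> C" "\<bar>x - c\<bar> < d c"
        using C(3) by (auto simp: dist_real_def abs_minus_commute)
      moreover have "\<bar>y - y1\<bar> < d c" by (rule less_le_trans[OF y(2)]) (use c C(2) in simp)
      ultimately show "F (x, y) = G (x, y)" using d(2)[of c x y] C(1) x y by auto
    qed
  qed
  moreover have "Min (d ` C) > 0"
  proof (subst Min_gr_iff)
    show "d ` C \<noteq> {}" using C(3) zero_le_one by force
    show "\<forall>a\<in>d ` C. 0 < a" using C(1) d(1) by blast
  qed (use C(2) in simp)
  ultimately show ?thesis by blast
qed

text \<open>The heights at which the selections agree along the whole line form a closed set by
  continuity in \<open>y\<close>, and an open one because agreement passes to nearby good lines. An
  interval is connected.\<close>

lemma eq_on_strip:
  assumes "{a<..<b} \<inter> Y = {}" "{a<..<b} \<subseteq> {0..1}" and m: "m \<in> {a<..<b}"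
    and eq: "\<And>x. x \<in> {0..1} \<Longrightarrow> F (x, m) = G (x, m)"
    and xy: "x \<in> {0..1}" "y \<in> {a<..<b}"
  shows "F (x, y) = G (x, y)"
proof -
  define E where "E = {y \<in> {a<..<b}. \<forall>x\<in>{0..1}. F (x, y) = G (x, y)}"
  have "E = (\<Inter>x\<in>{0..1}. {y \<in> {a<..<b}. F (x, y) - G (x, y) = 0})"
  proof (intro equalityI subsetI)
    fix y assume "y \<in> (\<Inter>x\<in>{0..1}. {y \<in> {a<..<b}. F (x, y) - G (x, y) = 0})"
    then have *: "y \<in> {a<..<b} \<and> F (x, y) = G (x, y)" if "x \<in> {0..1}" for x
      using that by simp
    show "y \<in> E" unfolding E_def using *[of 0] * by simp
  qed (simp add: E_def)
  moreover have "closedin (top_of_set {a<..<b}) {y \<in> {a<..<b}. F (x, y) - G (x, y) = 0}"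
    if "x \<in> {0..1}" for x
    using assms(2) that
    by (intro continuous_closedin_preimage_constant continuous_intros)
       (auto intro: continuous_on_subset[OF continuous_on_section(2)] F G)
  ultimately have "closedin (top_of_set {a<..<b}) E" by auto
  moreover have "openin (top_of_set {a<..<b}) E"
    unfolding openin_euclidean_subtopology_iff
  proof (intro conjI ballI)
    fix y1 assume y1: "y1 \<in> E"
    then have "y1 \<in> {0..1}" "y1 \<notin> Y" using assms by (auto simp: E_def)
    from eq_on_near_lines[OF this] y1 obtain d where d: "d > 0"
      "\<forall>y\<in>{0..1}. \<bar>y - y1\<bar> < d \<longrightarrow> y \<notin> Y \<longrightarrow> (\<forall>x\<in>{0..1}. F (x, y) = G (x, y))"
      by (auto simp: E_def)
    show "\<exists>e>0. \<forall>y\<in>{a<..<b}. dist y y1 < e \<longrightarrow> y \<in> E"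
    proof (intro exI[of _ d] conjI ballI impI)
      fix y assume "y \<in> {a<..<b}" "dist y y1 < d"
      moreover from this have "y \<in> {0..1}" "y \<notin> Y" using assms(1,2) by blast+
      ultimately show "y \<in> E" using d(2) by (simp add: E_def dist_real_def)
    qed (rule d)
  qed (auto simp: E_def)
  moreover have "m \<in> E" using m eq by (auto simp: E_def)
  ultimately have "E = {a<..<b}"
    using connected_Ioo[of a b] unfolding connected_clopen by blast
  then have "y \<in> E" using xy by simp
  then show ?thesis using xy by (simp add: E_def)
qed

end

section \<open>A finite determining set\<close>

text \<open>The points of \<open>T\<close> lie on finitely many good lines, at least one in each gap
  between bad heights, and on such a line every gap between roots of \<open>q\<close> contains one
  of them.\<close>

lemma finite_determining_set':
  "\<exists>T \<subseteq> unit_square. finite T \<and> (\<forall>F G. selection P unit_square F \<longrightarrow> selection P unit_square G \<longrightarrow>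
     (\<forall>z\<in>T. F z = G z) \<longrightarrow> (\<forall>z\<in>unit_square. F z = G z))"
proof -
  \<comment> \<open>With \<open>0\<close> and \<open>1\<close> added, every other height in the unit
    interval lies between two members.\<close>
  define Y0 where "Y0 = Y \<union> {0, 1}"
  define X where "X = (\<lambda>y. {x. poly (fibre y q) x = 0})"
  define mid where "mid = (\<lambda>(a, b). (a + b) / 2 :: real)"
  \<comment> \<open>Midpoints of all pairs are taken, so that consecutive members need not be
    singled out; those that are bad or outside the unit interval are dropped.\<close>
  define R where "R = mid ` (Y0 \<times> Y0) \<inter> {0..1} - Y0"
  define T where "T = (\<Union>y\<in>R. (\<lambda>p. (mid p, y)) ` (X y \<times> X y)) \<inter> unit_square"
  have fins: "finite Y0" "finite R" using finY by (auto simp: Y0_def R_def)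
  have finX: "finite (X y)" if "y \<notin> Y" for y using nz that by (auto simp: X_def poly_roots_finite)
  have finT: "finite T" using fins finX by (auto simp: T_def R_def Y0_def)
  have *: "F (x, y) = G (x, y)"
    if F: "selection P unit_square F" and G: "selection P unit_square G"
      and eqT: "\<forall>z\<in>T. F z = G z" and x: "x \<in> {0..1}" and y: "y \<in> {0..1}" for F G x y
  proof -
    have R: "F (x, y) = G (x, y)" if "y \<in> R" "x \<in> {0..1}" for x y
    proof (rule eq_on_line[OF F G _ _ _ that(2)])
      show y: "y \<in> {0..1}" "y \<notin> Y" using that by (auto simp: R_def Y0_def)
      fix x assume x: "x \<in> {0..1}" "poly (fibre y q) x \<noteq> 0"
      have "0 \<in> X y" "1 \<in> X y" "x \<notin> X y" using ends x by (auto simp: X_def)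
      moreover from this have "0 < x" "x < 1" using x by (auto simp: less_le)
      ultimately obtain a b where ab: "a \<in> X y" "b \<in> X y" "0 \<le> a" "a < x" "x < b" "b \<le> 1"
        "{a<..<b} \<inter> X y = {}"
        using finite_set_gap[OF finX[OF y(2)], of 0 1 x] by metis
      have m: "a < mid (a, b)" "mid (a, b) < b" using ab by (auto simp: mid_def)
      then have "(mid (a, b), y) \<in> T" using ab y that by (force simp: T_def)
      then have eq: "F (mid (a, b), y) = G (mid (a, b), y)" using eqT by blast
      have z: "\<forall>t\<in>{a<..<b}. poly (fibre y q) t \<noteq> 0" using ab(7) by (auto simp: X_def)
      show "F (x, y) = G (x, y)"
        by (rule eq_on_segment[OF F G _ _ y(1) z eq]) (use ab(3-6) m in auto)
    qed
    \<comment> \<open>The gap of \<open>Y0\<close> around \<open>y\<close> contains a line from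
      \<open>R\<close>, on which agreement is already known.\<close>
    have gen: "F (x, y) = G (x, y)" if y: "y \<in> {0..1}" "y \<notin> Y0" for y
    proof -
      have "0 < y" "y < 1" using y by (auto simp: Y0_def less_le)
      then obtain a b where ab: "a \<in> Y0" "b \<in> Y0" "0 \<le> a" "a < y" "y < b" "b \<le> 1"
        "{a<..<b} \<inter> Y0 = {}"
        using finite_set_gap[OF fins(1), of 0 1 y] y by (auto simp: Y0_def)
      have m: "mid (a, b) \<in> {a<..<b}" using ab by (auto simp: mid_def)
      then have "mid (a, b) \<in> R" using ab by (force simp: R_def)
      show ?thesis
      proof (rule eq_on_strip[OF F G _ _ m])
        show "{a<..<b} \<inter> Y = {}" using ab(7) by (auto simp: Y0_def)
        show "F (x, mid (a, b)) = G (x, mid (a, b))" if "x \<in> {0..1}" for x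
          using R[OF \<open>mid (a, b) \<in> R\<close> that] .
      qed (use ab x in auto)
    qed
    \<comment> \<open>Continuity in \<open>y\<close> reaches the finitely many heights in
      \<open>Y0\<close>.\<close>
    show ?thesis
      by (rule continuous_eq_off_finite[of 0 1 "\<lambda>y. F (x, y)" "\<lambda>y. G (x, y)" Y0])
         (use x y gen fins in \<open>auto intro!: continuous_on_section F G\<close>)
  qed
  show ?thesis
  proof (intro exI[of _ T] conjI allI impI ballI)
    show "T \<subseteq> unit_square" by (simp add: T_def)
    fix F G z
    assume "selection P unit_square F" "selection P unit_square G" "\<forall>z\<in>T. F z = G z" "z \<in> unit_square"
    with *[of F G "fst z" "snd z"] show "F z = G z" by (cases z) simp
  qed (rule finT)
qed

end

lemma finite_determining_set:
  fixes P :: "(real \<times> real \<Rightarrow> real) set"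
  assumes "finite P" "\<And>p. p \<in> P \<Longrightarrow> real_polynomial_function p"
  obtains T where "finite T" "T \<subseteq> unit_square"
    "\<forall>F G. selection P unit_square F \<longrightarrow> selection P unit_square G \<longrightarrow>
       (\<forall>z\<in>T. F z = G z) \<longrightarrow> (\<forall>z\<in>unit_square. F z = G z)"
proof -
  obtain A where A: "\<And>p x y. p \<in> P \<Longrightarrow> p (x, y) = poly (fibre y (A p)) x"
    using real_polynomial_function_fibre[OF assms(2)] by metis
  define D where "D = {(p, r) \<in> P \<times> P. p \<noteq> r}"
  \<comment> \<open>The first two factors are \<open>x\<close> and \<open>x - 1\<close>; the product
    vanishes wherever two distinct members of \<open>P\<close> coincide.\<close>
  define q where "q = [:0, 1:] * [:-1, 1:] * (\<Prod>(p, r)\<in>D. A p - A r)"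
  have finD: "finite D" using assms(1) by (auto simp: D_def intro: finite_subset[of _ "P \<times> P"])
  \<comment> \<open>Distinct functions have distinct representing polynomials, so no factor of the
    product is zero.\<close>
  have "A p \<noteq> A r" if "(p, r) \<in> D" for p r
  proof
    assume "A p = A r"
    then have "p (x, y) = r (x, y)" for x y using that A[of p x y] A[of r x y] by (simp add: D_def)
    then have "p = r" by auto
    then show False using that by (simp add: D_def)
  qed
  then have "(\<Prod>(p, r)\<in>D. A p - A r) \<noteq> 0" using finD by auto
  then have q0: "q \<noteq> 0" unfolding q_def mult_eq_0_iff by simp
  obtain h Y where hY: "finite Y" "\<And>y. y \<notin> Y \<Longrightarrow> fibre y q \<noteq> 0"
     "\<And>x y. y \<notin> Y \<Longrightarrow> poly (fibre y q) x = 0 \<Longrightarrow>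
        poly (fibre y h) x = 0 \<and> poly (pderiv (fibre y h)) x \<noteq> 0"
    using squarefree_fibres[OF q0] by metis
  have inj: "inj_on (\<lambda>p. p (x, y)) P" if "poly (fibre y q) x \<noteq> 0" for x y
  proof (rule inj_onI, rule ccontr)
    fix p r assume pr: "p \<in> P" "r \<in> P" "p (x, y) = r (x, y)" "p \<noteq> r"
    then have "(p, r) \<in> D" by (auto simp: D_def)
    moreover have "poly (fibre y (A p - A r)) x = 0" using pr A by (simp add: fibre_simps)
    ultimately have "poly (fibre y (\<Prod>(p, r)\<in>D. A p - A r)) x = 0"
      using finD by (force simp: fibre_prod poly_prod)
    then show False using that by (simp add: q_def fibre_simps del: mult_pCons_left)
  qed
  have ends: "poly (fibre y q) 0 = 0" "poly (fibre y q) 1 = 0" for y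
    by (simp_all add: q_def fibre_simps del: mult_pCons_left)
  have "continuous_on UNIV p" if "p \<in> P" for p
    using assms(2)[OF that]
    by (simp add: continuous_on_polymonial_function real_polynomial_function_eq)
  from finite_determining_set'[OF assms(1) this inj hY ends] show ?thesis
    using that by blast
qed

section \<open>Order types of point sequences\<close>

text \<open>The value at \<open>j\<close> is one more than the number of smaller values, which the
  comparisons determine.\<close>

lemma permutes_strict_mono_unique:
  fixes \<sigma> \<sigma>' :: "nat \<Rightarrow> nat"
  assumes "\<sigma> permutes {1..n}" "\<sigma>' permutes {1..n}"
    and "\<And>i j. i \<in> {1..n} \<Longrightarrow> j \<in> {1..n} \<Longrightarrow> \<sigma> i < \<sigma> j \<longleftrightarrow> \<sigma>' i < \<sigma>' j"
  shows "\<sigma> = \<sigma>'"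
proof -
  have rank: "card {i \<in> {1..n}. s i < s j} = s j - 1" if s: "s permutes {1..n}" and j: "j \<in> {1..n}"
    for s :: "nat \<Rightarrow> nat" and j
  proof -
    have "s ` {i \<in> {1..n}. s i < s j} = {1..<s j}"
    proof (intro equalityI subsetI)
      fix k assume k: "k \<in> {1..<s j}"
      have "s j \<in> {1..n}" using permutes_in_image[OF s] j by blast
      then have "k \<in> s ` {1..n}" using k permutes_image[OF s] by auto
      then show "k \<in> s ` {i \<in> {1..n}. s i < s j}" using k by auto
    next
      fix k assume "k \<in> s ` {i \<in> {1..n}. s i < s j}"
      then obtain i where "i \<in> {1..n}" "s i < s j" "k = s i" by auto
      moreover from this have "s i \<in> {1..n}" using permutes_in_image[OF s] by blast
      ultimately show "k \<in> {1..<s j}" by simp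
    qed
    then have "card {1..<s j} = card {i \<in> {1..n}. s i < s j}"
      using permutes_inj_on[OF s] by (metis card_image)
    then show ?thesis by simp
  qed
  have "\<sigma> j = \<sigma>' j" for j
  proof (cases "j \<in> {1..n}")
    case True
    have "{i \<in> {1..n}. \<sigma> i < \<sigma> j} = {i \<in> {1..n}. \<sigma>' i < \<sigma>' j}" using assms(3) True by blast
    then have "\<sigma> j - 1 = \<sigma>' j - 1" using rank[OF assms(1) True] rank[OF assms(2) True] by simp
    moreover have "\<sigma> j \<in> {1..n}" "\<sigma>' j \<in> {1..n}"
      using permutes_in_image[OF assms(1)] permutes_in_image[OF assms(2)] True by blast+
    ultimately show ?thesis unfolding atLeastAtMost_iff by linarith
  next
    case False
    then show ?thesis using assms(1,2) by (simp add: permutes_not_in)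
  qed
  then show ?thesis by blast
qed

text \<open>The rank of \<open>i\<close> is the number of \<open>k\<close> with
  \<open>f k \<le> f i\<close>; injectivity of \<open>f\<close> makes the ranks distinct.\<close>

lemma ex_rank_permutation:
  fixes f :: "nat \<Rightarrow> 'a::linorder"
  assumes inj: "inj_on f {1..n}"
  shows "\<exists>\<sigma>. \<sigma> permutes {1..n} \<and> (\<forall>i\<in>{1..n}. \<forall>j\<in>{1..n}. \<sigma> i < \<sigma> j \<longleftrightarrow> f i < f j)"
proof -
  define r where "r i = card {k \<in> {1..n}. f k \<le> f i}" for i
  have less: "r i < r j" if "i \<in> {1..n}" "j \<in> {1..n}" "f i < f j" for i j
    unfolding r_def
  proof (rule psubset_card_mono)
    show "{k \<in> {1..n}. f k \<le> f i} \<subset> {k \<in> {1..n}. f k \<le> f j}"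
    proof (rule psubsetI)
      show "{k \<in> {1..n}. f k \<le> f i} \<subseteq> {k \<in> {1..n}. f k \<le> f j}"
        using that(3) by (blast intro: order.trans less_imp_le)
      have "j \<in> {k \<in> {1..n}. f k \<le> f j}" "j \<notin> {k \<in> {1..n}. f k \<le> f i}"
        using that by (simp_all add: not_le)
      then show "{k \<in> {1..n}. f k \<le> f i} \<noteq> {k \<in> {1..n}. f k \<le> f j}" by blast
    qed
  qed simp
  have eq: "r i < r j \<longleftrightarrow> f i < f j" if "i \<in> {1..n}" "j \<in> {1..n}" for i j
  proof (cases "i = j")
    case False
    then have "f i \<noteq> f j" using inj that by (auto dest: inj_onD)
    then show ?thesis using less[of i j] less[of j i] that by (metis less_asym linorder_neqE)
  qed simp
  have "inj_on r {1..n}"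
  proof (rule inj_onI)
    fix i j assume *: "i \<in> {1..n}" "j \<in> {1..n}" "r i = r j"
    then have "\<not> f i < f j" "\<not> f j < f i" using eq[of i j] eq[of j i] by simp_all
    then have "f i = f j" by simp
    then show "i = j" using inj * by (auto dest: inj_onD)
  qed
  moreover have "r ` {1..n} \<subseteq> {1..n}"
  proof
    fix k assume "k \<in> r ` {1..n}"
    then obtain i where i: "i \<in> {1..n}" "k = r i" by auto
    have "card {k \<in> {1..n}. f k \<le> f i} \<le> card {1..n}" by (rule card_mono) auto
    moreover have "0 < card {k \<in> {1..n}. f k \<le> f i}" using i by (subst card_gt_0_iff) auto
    ultimately show "k \<in> {1..n}" using i by (simp add: r_def)
  qed
  ultimately have "bij_betw r {1..n} {1..n}"
    by (simp add: bij_betw_def endo_inj_surj)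
  \<comment> \<open>A permutation has to fix everything outside \<open>{1..n}\<close>, so the ranks
    are extended by the identity.\<close>
  then have "bij_betw (\<lambda>i. if i \<in> {1..n} then r i else i) {1..n} {1..n}"
    by (rule bij_betw_cong[THEN iffD1, rotated]) simp
  then have "(\<lambda>i. if i \<in> {1..n} then r i else i) permutes {1..n}"
    by (rule bij_imp_permutes) (simp only: if_False)
  then show ?thesis using eq by (intro exI[of _ "\<lambda>i. if i \<in> {1..n} then r i else i"]) simp
qed

text \<open>The comparisons are recorded as sets so that having the same relative order becomes an
  equation, with finitely many possible values for each \<open>n\<close>.\<close>

definition order_type :: "nat \<Rightarrow> (nat \<Rightarrow> real \<times> real) \<Rightarrow> (nat \<times> nat) set \<times> (nat \<times> nat) set" where
  "order_type n pt =
     ({(i, j) \<in> {1..n} \<times> {1..n}. fst (pt i) < fst (pt j)},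
      {(i, j) \<in> {1..n} \<times> {1..n}. snd (pt i) < snd (pt j)})"

text \<open>The graph of \<open>\<pi>\<close>, serving as the standard sequence of points that
  induces it.\<close>

definition perm_points :: "(nat \<Rightarrow> nat) \<Rightarrow> nat \<Rightarrow> real \<times> real" where
  "perm_points \<pi> i = (real i, real (\<pi> i))"

lemma order_type_eq_iff:
  "order_type n pt = order_type n pt' \<longleftrightarrow>
     (\<forall>i\<in>{1..n}. \<forall>j\<in>{1..n}. (fst (pt i) < fst (pt j) \<longleftrightarrow> fst (pt' i) < fst (pt' j)) \<and>
        (snd (pt i) < snd (pt j) \<longleftrightarrow> snd (pt' i) < snd (pt' j)))"
  unfolding order_type_def prod.inject set_eq_iff by blast

lemma order_type_comp:
  assumes "order_type n pt = order_type n pt'" "\<tau> permutes {1..n}"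
  shows "order_type n (pt \<circ> \<tau>) = order_type n (pt' \<circ> \<tau>)"
  using assms(1) permutes_in_image[OF assms(2)] unfolding order_type_eq_iff comp_def by blast

lemma order_type_restrict: "order_type n (restrict pt {1..n}) = order_type n pt"
  by (simp add: order_type_eq_iff)

text \<open>Separates the pattern \<open>\<pi>\<close> from the labelling: \<open>\<sigma> i\<close>
  is the rank of point \<open>i\<close> from the left, the inverse of the enumeration
  \<open>\<iota>\<close>.\<close>

lemma induces_perm_iff:
  assumes \<pi>: "\<pi> permutes {1..n}"
  shows "induces_perm n pt \<pi> \<longleftrightarrow>
    (\<exists>\<sigma>. \<sigma> permutes {1..n} \<and> order_type n pt = order_type n (perm_points \<pi> \<circ> \<sigma>))"
proof
  assume "induces_perm n pt \<pi>"
  then obtain \<iota> where \<iota>: "bij_betw \<iota> {1..n} {1..n}" "strict_mono_on {1..n} (\<lambda>j. fst (pt (\<iota> j)))"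
    "\<And>j j'. j \<in> {1..n} \<Longrightarrow> j' \<in> {1..n} \<Longrightarrow> \<pi> j < \<pi> j' \<longleftrightarrow> snd (pt (\<iota> j)) < snd (pt (\<iota> j'))"
    unfolding induces_perm_def by blast
  define \<sigma> where "\<sigma> i = (if i \<in> {1..n} then inv_into {1..n} \<iota> i else i)" for i
  have "bij_betw (inv_into {1..n} \<iota>) {1..n} {1..n}" using \<iota>(1) by (rule bij_betw_inv_into)
  then have bij: "bij_betw \<sigma> {1..n} {1..n}"
    by (rule bij_betw_cong[THEN iffD1, rotated]) (simp add: \<sigma>_def)
  then have \<sigma>: "\<sigma> permutes {1..n}" by (rule bij_imp_permutes) (simp only: \<sigma>_def if_False)
  have in\<sigma>: "\<sigma> i \<in> {1..n}" if "i \<in> {1..n}" for i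
    using bij_betwE[OF bij] that by blast
  have \<iota>\<sigma>: "\<iota> (\<sigma> i) = i" if "i \<in> {1..n}" for i
    unfolding \<sigma>_def using bij_betw_inv_into_right[OF \<iota>(1) that] that by simp
  have "order_type n pt = order_type n (perm_points \<pi> \<circ> \<sigma>)"
    unfolding order_type_eq_iff
  proof (intro ballI conjI)
    fix i j assume ij: "i \<in> {1..n}" "j \<in> {1..n}"
    show "(fst (pt i) < fst (pt j)) \<longleftrightarrow> fst ((perm_points \<pi> \<circ> \<sigma>) i) < fst ((perm_points \<pi> \<circ> \<sigma>) j)"
      using strict_mono_on_less[OF \<iota>(2) in\<sigma>[OF ij(1)] in\<sigma>[OF ij(2)]] \<iota>\<sigma>[OF ij(1)] \<iota>\<sigma>[OF ij(2)]
      by (simp add: perm_points_def)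
    show "(snd (pt i) < snd (pt j)) \<longleftrightarrow> snd ((perm_points \<pi> \<circ> \<sigma>) i) < snd ((perm_points \<pi> \<circ> \<sigma>) j)"
      using \<iota>(3)[OF in\<sigma>[OF ij(1)] in\<sigma>[OF ij(2)]] \<iota>\<sigma>[OF ij(1)] \<iota>\<sigma>[OF ij(2)]
      by (simp add: perm_points_def)
  qed
  with \<sigma> show "\<exists>\<sigma>. \<sigma> permutes {1..n} \<and> order_type n pt = order_type n (perm_points \<pi> \<circ> \<sigma>)" by blast
next
  assume "\<exists>\<sigma>. \<sigma> permutes {1..n} \<and> order_type n pt = order_type n (perm_points \<pi> \<circ> \<sigma>)"
  then obtain \<sigma> where \<sigma>: "\<sigma> permutes {1..n}" and ot: "order_type n pt = order_type n (perm_points \<pi> \<circ> \<sigma>)"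
    by blast
  have inv: "inv \<sigma> permutes {1..n}" using \<sigma> by (rule permutes_inv)
  have "order_type n (pt \<circ> inv \<sigma>) = order_type n (perm_points \<pi> \<circ> \<sigma> \<circ> inv \<sigma>)"
    by (rule order_type_comp[OF ot inv])
  also have "perm_points \<pi> \<circ> \<sigma> \<circ> inv \<sigma> = perm_points \<pi>"
    using permutes_inv_o(1)[OF \<sigma>] by (simp add: comp_assoc)
  finally have *: "order_type n (pt \<circ> inv \<sigma>) = order_type n (perm_points \<pi>)" .
  show "induces_perm n pt \<pi>"
    unfolding induces_perm_def
  proof (intro exI[of _ "inv \<sigma>"] conjI)
    show "bij_betw (inv \<sigma>) {1..n} {1..n}" using inv by (rule permutes_imp_bij)
    show "strict_mono_on {1..n} (\<lambda>j. fst (pt (inv \<sigma> j)))"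
      using * unfolding order_type_eq_iff by (auto simp: strict_mono_on_def perm_points_def)
    show "\<forall>j\<in>{1..n}. \<forall>j'\<in>{1..n}. \<pi> j < \<pi> j' \<longleftrightarrow> snd (pt (inv \<sigma> j)) < snd (pt (inv \<sigma> j'))"
      using * unfolding order_type_eq_iff by (auto simp: perm_points_def)
  qed
qed

text \<open>The ranks of the first coordinates give \<open>\<sigma>\<close>, those of the second
  give \<open>\<pi> \<circ> \<sigma>\<close>; both are determined by the order, and cancelling
  \<open>\<sigma>\<close> leaves \<open>\<pi>\<close>.\<close>

lemma ex1_induces_perm:
  assumes "inj_on (fst \<circ> pt) {1..n}" "inj_on (snd \<circ> pt) {1..n}"
  shows "\<exists>!\<pi>. \<pi> permutes {1..n} \<and> induces_perm n pt \<pi>"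
proof (rule ex_ex1I)
  obtain \<sigma> where \<sigma>: "\<sigma> permutes {1..n}" "\<forall>i\<in>{1..n}. \<forall>j\<in>{1..n}. \<sigma> i < \<sigma> j \<longleftrightarrow> (fst \<circ> pt) i < (fst \<circ> pt) j"
    using ex_rank_permutation[OF assms(1)] by blast
  obtain \<rho> where \<rho>: "\<rho> permutes {1..n}" "\<forall>i\<in>{1..n}. \<forall>j\<in>{1..n}. \<rho> i < \<rho> j \<longleftrightarrow> (snd \<circ> pt) i < (snd \<circ> pt) j"
    using ex_rank_permutation[OF assms(2)] by blast
  have \<pi>: "\<rho> \<circ> inv \<sigma> permutes {1..n}" using \<sigma> \<rho> by (intro permutes_compose permutes_inv)
  have "order_type n pt = order_type n (perm_points (\<rho> \<circ> inv \<sigma>) \<circ> \<sigma>)"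
    using \<sigma>(2) \<rho>(2) permutes_inverses(2)[OF \<sigma>(1)] by (simp add: order_type_eq_iff perm_points_def)
  then have "induces_perm n pt (\<rho> \<circ> inv \<sigma>)" unfolding induces_perm_iff[OF \<pi>] using \<sigma>(1) by blast
  with \<pi> show "\<exists>\<pi>. \<pi> permutes {1..n} \<and> induces_perm n pt \<pi>" by blast
next
  fix \<pi> \<pi>'
  assume 1: "\<pi> permutes {1..n} \<and> induces_perm n pt \<pi>" and 2: "\<pi>' permutes {1..n} \<and> induces_perm n pt \<pi>'"
  then obtain \<sigma> \<sigma>' where \<sigma>: "\<sigma> permutes {1..n}" "order_type n pt = order_type n (perm_points \<pi> \<circ> \<sigma>)"
    and \<sigma>': "\<sigma>' permutes {1..n}" "order_type n pt = order_type n (perm_points \<pi>' \<circ> \<sigma>')"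
    using induces_perm_iff by metis
  have eq: "\<sigma> i < \<sigma> j \<longleftrightarrow> \<sigma>' i < \<sigma>' j" "(\<pi> \<circ> \<sigma>) i < (\<pi> \<circ> \<sigma>) j \<longleftrightarrow> (\<pi>' \<circ> \<sigma>') i < (\<pi>' \<circ> \<sigma>') j"
    if "i \<in> {1..n}" "j \<in> {1..n}" for i j
    using \<sigma>(2) \<sigma>'(2) that by (auto simp: order_type_eq_iff perm_points_def)
  have "\<sigma> = \<sigma>'" by (rule permutes_strict_mono_unique[OF \<sigma>(1) \<sigma>'(1) eq(1)])
  have "\<pi> \<circ> \<sigma> = \<pi>' \<circ> \<sigma>'"
    by (rule permutes_strict_mono_unique[OF _ _ eq(2)]) (use 1 2 \<sigma>(1) \<sigma>'(1) permutes_compose in blast)+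
  then have "\<pi> \<circ> \<sigma> \<circ> inv \<sigma> = \<pi>' \<circ> \<sigma> \<circ> inv \<sigma>" using \<open>\<sigma> = \<sigma>'\<close> by simp
  then show "\<pi> = \<pi>'" using permutes_inv_o(1)[OF \<sigma>(1)] by (simp add: comp_assoc)
qed

text \<open>Composition with the labelling \<open>\<sigma>\<close> of the points is a bijection
  between the two sets of relabellings.\<close>

lemma card_order_invariant:
  assumes "\<pi> permutes {1..n}" "induces_perm n pt \<pi>"
    and E: "\<And>pt pt'. order_type n pt = order_type n pt' \<Longrightarrow> E pt \<longleftrightarrow> E pt'"
  shows "card {\<tau>. \<tau> permutes {1..n} \<and> E (pt \<circ> \<tau>)} =
    card {\<tau>. \<tau> permutes {1..n} \<and> E (perm_points \<pi> \<circ> \<tau>)}"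
proof -
  obtain \<sigma> where \<sigma>: "\<sigma> permutes {1..n}" "order_type n pt = order_type n (perm_points \<pi> \<circ> \<sigma>)"
    using assms(2) unfolding induces_perm_iff[OF assms(1)] by blast
  have *: "E (pt \<circ> \<tau>) \<longleftrightarrow> E (perm_points \<pi> \<circ> (\<sigma> \<circ> \<tau>))" if "\<tau> permutes {1..n}" for \<tau>
    using E[OF order_type_comp[OF \<sigma>(2) that]] by (simp add: comp_assoc)
  have "bij_betw (\<lambda>\<tau>. \<sigma> \<circ> \<tau>) {\<tau>. \<tau> permutes {1..n} \<and> E (pt \<circ> \<tau>)}
      {\<tau>. \<tau> permutes {1..n} \<and> E (perm_points \<pi> \<circ> \<tau>)}"
  proof (rule bij_betwI[where g = "\<lambda>\<tau>. inv \<sigma> \<circ> \<tau>"])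
    show "(\<circ>) \<sigma> \<in> {\<tau>. \<tau> permutes {1..n} \<and> E (pt \<circ> \<tau>)} \<rightarrow>
        {\<tau>. \<tau> permutes {1..n} \<and> E (perm_points \<pi> \<circ> \<tau>)}"
      using * permutes_compose[OF _ \<sigma>(1)] by auto
    have "\<sigma> \<circ> (inv \<sigma> \<circ> \<tau>) = \<tau>" "inv \<sigma> \<circ> (\<sigma> \<circ> \<tau>) = \<tau>" for \<tau> :: "nat \<Rightarrow> nat"
      using permutes_inv_o[OF \<sigma>(1)] by (simp_all flip: comp_assoc)
    then show "(\<circ>) (inv \<sigma>) \<in> {\<tau>. \<tau> permutes {1..n} \<and> E (perm_points \<pi> \<circ> \<tau>)} \<rightarrow>
        {\<tau>. \<tau> permutes {1..n} \<and> E (pt \<circ> \<tau>)}"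
      "\<sigma> \<circ> (inv \<sigma> \<circ> \<tau>) = \<tau>" "inv \<sigma> \<circ> (\<sigma> \<circ> \<tau>) = \<tau>" for \<tau> :: "nat \<Rightarrow> nat"
      using * permutes_compose[OF _ permutes_inv[OF \<sigma>(1)]] by auto
  qed
  then show ?thesis by (rule bij_betw_same_card)
qed

section \<open>Probabilities of order events\<close>

lemma permutonD:
  assumes "permuton \<mu>"
  shows "prob_space \<mu>" "sets \<mu> = sets (restrict_space borel unit_square)" "space \<mu> = unit_square"
    "\<And>a b. 0 \<le> a \<Longrightarrow> a \<le> b \<Longrightarrow> b \<le> 1 \<Longrightarrow> measure \<mu> ({a..b} \<times> {0..1}) = b - a"
    "\<And>a b. 0 \<le> a \<Longrightarrow> a \<le> b \<Longrightarrow> b \<le> 1 \<Longrightarrow> measure \<mu> ({0..1} \<times> {a..b}) = b - a"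
proof -
  show 1: "sets \<mu> = sets (restrict_space borel unit_square)"
    using assms by (simp add: permuton_def)
  show "space \<mu> = unit_square"
    using sets_eq_imp_space_eq[OF 1] by (simp add: space_restrict_space)
qed (use assms in \<open>simp_all add: permuton_def\<close>)

lemma permuton_measurable:
  assumes "permuton \<mu>" "f \<in> measurable borel N"
  shows "f \<in> measurable \<mu> N"
  using measurable_restrict_space1[OF assms(2), of unit_square]
    measurable_cong_sets[OF permutonD(2)[OF assms(1)] refl] by blast

lemma permuton_null_lines:
  assumes "permuton \<mu>"
  shows "emeasure \<mu> {z \<in> space \<mu>. fst z = c} = 0" "emeasure \<mu> {z \<in> space \<mu>. snd z = c} = 0"
proof -
  interpret prob_space \<mu> by (rule permutonD(1)[OF assms])
  have "emeasure \<mu> ({c} \<times> {0..1}) = 0" "emeasure \<mu> ({0..1} \<times> {c}) = 0" if "c \<in> {0..1}"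
    using permutonD(4,5)[OF assms, of c c] that by (simp_all add: emeasure_eq_measure)
  moreover have "{z \<in> space \<mu>. fst z = c} = (if c \<in> {0..1} then {c} \<times> {0..1} else {})"
    "{z \<in> space \<mu>. snd z = c} = (if c \<in> {0..1} then {0..1} \<times> {c} else {})"
    by (auto simp: permutonD(3)[OF assms])
  ultimately show "emeasure \<mu> {z \<in> space \<mu>. fst z = c} = 0" "emeasure \<mu> {z \<in> space \<mu>. snd z = c} = 0"
    by (simp_all del: atLeastAtMost_iff split: if_splits)
qed

text \<open>The events whose probabilities turn out to be combinations of permutation
  densities.\<close>

definition order_invariant :: "nat \<Rightarrow> ((nat \<Rightarrow> real \<times> real) \<Rightarrow> bool) \<Rightarrow> bool" where
  "order_invariant n E \<longleftrightarrow> (\<forall>pt pt'. order_type n pt = order_type n pt' \<longrightarrow> (E pt \<longleftrightarrow> E pt'))"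

text \<open>There are finitely many order types, so the event is a finite union of events given by
  comparisons of coordinates.\<close>

lemma order_invariant_measurable:
  assumes \<mu>: "permuton \<mu>" and E: "order_invariant n E"
  shows "Measurable.pred (PiM {1..n} (\<lambda>_. \<mu>)) E"
proof -
  let ?M = "PiM {1..n} (\<lambda>_. \<mu>)"
  define \<O> where "\<O> = Pow ({1..n} \<times> {1..n}) \<times> Pow ({1..n} \<times> {1..n})"
  have [measurable]: "fst \<in> borel_measurable \<mu>" "snd \<in> borel_measurable \<mu>"
    by (auto intro!: permuton_measurable[OF \<mu>] borel_measurable_continuous_onI continuous_intros)
  have E_iff: "E pt \<longleftrightarrow> (\<exists>t\<in>\<O>. (\<exists>pt'. order_type n pt' = t \<and> E pt') \<and>
     (\<forall>i\<in>{1..n}. \<forall>j\<in>{1..n}. ((i, j) \<in> fst t \<longleftrightarrow> fst (pt i) < fst (pt j)) \<and>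
        ((i, j) \<in> snd t \<longleftrightarrow> snd (pt i) < snd (pt j))))" for pt
  proof -
    have "(\<forall>i\<in>{1..n}. \<forall>j\<in>{1..n}. ((i, j) \<in> fst t \<longleftrightarrow> fst (pt i) < fst (pt j)) \<and>
        ((i, j) \<in> snd t \<longleftrightarrow> snd (pt i) < snd (pt j))) \<longleftrightarrow> t = order_type n pt" if "t \<in> \<O>" for t
      using that by (cases t) (auto simp: \<O>_def order_type_def)
    moreover have "order_type n pt \<in> \<O>" by (auto simp: \<O>_def order_type_def)
    moreover have "(\<exists>pt'. order_type n pt' = order_type n pt \<and> E pt') \<longleftrightarrow> E pt"
      using E unfolding order_invariant_def by blast
    ultimately show ?thesis by auto
  qed
  have "finite \<O>" by (simp add: \<O>_def)
  have c[measurable]: "(\<lambda>x. fst (x i)) \<in> borel_measurable ?M" "(\<lambda>x. snd (x i)) \<in> borel_measurable ?M"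
    if "i \<in> {1..n}" for i
    using that by measurable
  have "Measurable.pred ?M (\<lambda>pt. ((i, j) \<in> fst t \<longleftrightarrow> fst (pt i) < fst (pt j)) \<and>
        ((i, j) \<in> snd t \<longleftrightarrow> snd (pt i) < snd (pt j)))" if "i \<in> {1..n}" "j \<in> {1..n}" for i j t
    using that by measurable
  then have "Measurable.pred ?M (\<lambda>pt. \<forall>i\<in>{1..n}. \<forall>j\<in>{1..n}.
      ((i, j) \<in> fst t \<longleftrightarrow> fst (pt i) < fst (pt j)) \<and>
      ((i, j) \<in> snd t \<longleftrightarrow> snd (pt i) < snd (pt j)))" for t
    by (intro pred_intros_finite(3)) simp_all
  then have "Measurable.pred ?M (\<lambda>pt. (\<exists>pt'. order_type n pt' = t \<and> E pt') \<and>
     (\<forall>i\<in>{1..n}. \<forall>j\<in>{1..n}. ((i, j) \<in> fst t \<longleftrightarrow> fst (pt i) < fst (pt j)) \<and>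
        ((i, j) \<in> snd t \<longleftrightarrow> snd (pt i) < snd (pt j))))" for t
    by (rule pred_intros_logic(3)[rotated]) simp
  then have "Measurable.pred ?M (\<lambda>pt. \<exists>t\<in>\<O>. (\<exists>pt'. order_type n pt' = t \<and> E pt') \<and>
     (\<forall>i\<in>{1..n}. \<forall>j\<in>{1..n}. ((i, j) \<in> fst t \<longleftrightarrow> fst (pt i) < fst (pt j)) \<and>
        ((i, j) \<in> snd t \<longleftrightarrow> snd (pt i) < snd (pt j))))"
    using \<open>finite \<O>\<close> by (intro pred_intros_finite(4))
  then show ?thesis by (simp only: E_iff[symmetric])
qed

text \<open>With all other points fixed, a coincidence confines point \<open>i\<close> to a
  horizontal or vertical line, which is null; Tonelli does the rest.\<close>

lemma AE_distinct_coordinates: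
  fixes n :: nat
  assumes \<mu>: "permuton \<mu>"
  shows "AE pt in PiM {1..n} (\<lambda>_. \<mu>). inj_on (fst \<circ> pt) {1..n} \<and> inj_on (snd \<circ> pt) {1..n}"
proof -
  let ?M = "PiM {1..n} (\<lambda>_. \<mu>)"
  interpret prob_space \<mu> by (rule permutonD(1)[OF \<mu>])
  interpret product_sigma_finite "\<lambda>_::nat. \<mu>" ..
  have m: "fst \<in> borel_measurable \<mu>" "snd \<in> borel_measurable \<mu>"
    by (auto intro!: permuton_measurable[OF \<mu>] borel_measurable_continuous_onI continuous_intros)
  have "AE pt in ?M. f (pt i) \<noteq> f (pt j)"
    if ij: "i \<in> {1..n}" "j \<in> {1..n}" "i \<noteq> j" and f[measurable]: "f \<in> borel_measurable \<mu>"
      and 0: "\<And>c. emeasure \<mu> {z \<in> space \<mu>. f z = c} = 0" for i j and f :: "real \<times> real \<Rightarrow> real"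
  proof -
    define I where "I = {1..n} - {i}"
    have I: "{1..n} = insert i I" "finite I" "i \<notin> I" "j \<in> I" using ij by (auto simp: I_def)
    let ?A = "{pt \<in> space ?M. f (pt i) = f (pt j)}"
    have [measurable]: "?A \<in> sets ?M" using ij(1,2) by measurable
    have "emeasure ?M ?A = (\<integral>\<^sup>+pt. indicator ?A pt \<partial>?M)"
      by (rule nn_integral_indicator[symmetric]) fact
    also have "\<dots> = (\<integral>\<^sup>+x. (\<integral>\<^sup>+z. indicator ?A (x(i := z)) \<partial>\<mu>) \<partial>PiM I (\<lambda>_. \<mu>))"
      unfolding I(1)
      by (rule product_nn_integral_insert[OF I(2,3)]) (use \<open>?A \<in> sets ?M\<close> I(1) in simp)
    also have "\<dots> = (\<integral>\<^sup>+x. 0 \<partial>PiM I (\<lambda>_. \<mu>))"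
    proof (rule nn_integral_cong)
      fix x assume "x \<in> space (PiM I (\<lambda>_. \<mu>))"
      then have "indicator ?A (x(i := z)) = indicator {z \<in> space \<mu>. f z = f (x j)} z" if "z \<in> space \<mu>" for z
        using that I ij by (auto simp: indicator_def space_PiM PiE_def extensional_def)
      then have "(\<integral>\<^sup>+z. indicator ?A (x(i := z)) \<partial>\<mu>) = (\<integral>\<^sup>+z. indicator {z \<in> space \<mu>. f z = f (x j)} z \<partial>\<mu>)"
        by (intro nn_integral_cong) auto
      also have "\<dots> = emeasure \<mu> {z \<in> space \<mu>. f z = f (x j)}"
        by (rule nn_integral_indicator) measurable
      finally show "(\<integral>\<^sup>+z. indicator ?A (x(i := z)) \<partial>\<mu>) = 0" using 0 by simp
    qed
    finally have "?A \<in> null_sets ?M" using \<open>?A \<in> sets ?M\<close> by (auto simp: null_sets_def)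
    then show ?thesis by (rule AE_I') auto
  qed
  from this[OF _ _ _ m(1) permuton_null_lines(1)[OF \<mu>]] this[OF _ _ _ m(2) permuton_null_lines(2)[OF \<mu>]]
  have "AE pt in ?M. \<forall>i\<in>{1..n}. \<forall>j\<in>{1..n} - {i}. fst (pt i) \<noteq> fst (pt j) \<and> snd (pt i) \<noteq> snd (pt j)"
    by (intro AE_finite_allI finite_atLeastAtMost finite_Diff AE_conjI) auto
  then show ?thesis by (rule eventually_mono) (auto simp: inj_on_def)
qed

text \<open>The events \<open>E (pt \<circ> \<tau>)\<close> are equally likely for all relabellings \<open>\<tau>\<close>, and the number of \<open>\<tau>\<close>
  for which \<open>E (pt \<circ> \<tau>)\<close> holds depends only on the permutation induced by \<open>pt\<close>.\<close>

lemma prob_order_event: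
  assumes \<mu>: "permuton \<mu>" and E: "order_invariant n E"
  defines "M \<equiv> PiM {1..n} (\<lambda>_. \<mu>)"
  shows "fact n * measure M {pt \<in> space M. E pt} =
    (\<Sum>\<pi> | \<pi> permutes {1..n}. real (card {\<tau>. \<tau> permutes {1..n} \<and> E (perm_points \<pi> \<circ> \<tau>)}) *
       perm_density (n, \<pi>) \<mu>)"
proof -
  interpret \<mu>: prob_space \<mu> by (rule permutonD(1)[OF \<mu>])
  interpret M: prob_space M unfolding M_def by (intro prob_space_PiM) unfold_locales
  let ?S = "{\<tau>. \<tau> permutes {1..n}}"
  have finS: "finite ?S" by (rule finite_permutations) simp
  have E': "E pt \<longleftrightarrow> E pt'" if "order_type n pt = order_type n pt'" for pt pt'
    using E that unfolding order_invariant_def by blast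
  have meas: "{pt \<in> space M. Q pt} \<in> sets M" if "order_invariant n Q" for Q
    using order_invariant_measurable[OF \<mu> that] by (simp add: M_def pred_def)
  have invE: "order_invariant n (\<lambda>pt. E (pt \<circ> \<tau>))" if "\<tau> \<in> ?S" for \<tau>
    unfolding order_invariant_def using that E'[OF order_type_comp] by blast
  have invP: "order_invariant n (\<lambda>pt. induces_perm n pt \<pi>)" if "\<pi> \<in> ?S" for \<pi>
    using that by (simp add: order_invariant_def induces_perm_iff)
  have shuffle: "measure M {pt \<in> space M. E (pt \<circ> \<tau>)} = measure M {pt \<in> space M. E pt}"
    if \<tau>: "\<tau> \<in> ?S" for \<tau>
  proof -
    \<comment> \<open>Samples are \<open>undefined\<close> off \<open>{1..n}\<close>, so the
      relabelled one is restricted; this leaves its order type unchanged.\<close>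
    let ?t = "\<lambda>\<omega>. \<lambda>i\<in>{1..n}. \<omega> (\<tau> i)"
    have img: "\<tau> \<in> {1..n} \<rightarrow> {1..n}" using \<tau> permutes_in_image by fastforce
    have d: "distr M M ?t = M"
      unfolding M_def using distr_PiM_reindex[of "{1..n}" "\<lambda>_. \<mu>" \<tau> "{1..n}"] \<tau> img
      by (simp add: \<mu>.prob_space_axioms permutes_inj_on)
    have t: "?t \<in> measurable M M"
      unfolding M_def using img by (intro measurable_restrict measurable_component_singleton) auto
    have "measure M {pt \<in> space M. E pt} = measure (distr M M ?t) {pt \<in> space M. E pt}" by (simp only: d)
    also have "\<dots> = measure M (?t -` {pt \<in> space M. E pt} \<inter> space M)"
      by (rule measure_distr[OF t meas[OF E]])
    also have "?t -` {pt \<in> space M. E pt} \<inter> space M = {pt \<in> space M. E (pt \<circ> \<tau>)}"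
    proof -
      have "E (?t pt) \<longleftrightarrow> E (pt \<circ> \<tau>)" for pt
        using E'[OF order_type_restrict[of n "pt \<circ> \<tau>"]] by (simp add: comp_def)
      then show ?thesis using measurable_space[OF t] by auto
    qed
    finally show ?thesis ..
  qed
  have "fact n * measure M {pt \<in> space M. E pt} = (\<Sum>\<tau>\<in>?S. measure M {pt \<in> space M. E (pt \<circ> \<tau>)})"
    using shuffle card_permutations[OF refl, of "{1..n}"] by simp
  also have "\<dots> = (\<Sum>\<tau>\<in>?S. \<integral>pt. indicator {pt \<in> space M. E (pt \<circ> \<tau>)} pt \<partial>M)"
    using meas[OF invE] by simp
  also have "\<dots> = (\<integral>pt. (\<Sum>\<tau>\<in>?S. indicator {pt \<in> space M. E (pt \<circ> \<tau>)} pt) \<partial>M)"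
    using meas[OF invE] by (intro Bochner_Integration.integral_sum[symmetric] integrable_real_indicator)
      (auto simp: M.emeasure_eq_measure)
  also have "\<dots> = (\<integral>pt. (\<Sum>\<pi>\<in>?S. real (card {\<tau>. \<tau> permutes {1..n} \<and> E (perm_points \<pi> \<circ> \<tau>)}) *
      indicator {pt \<in> space M. induces_perm n pt \<pi>} pt) \<partial>M)"
  \<comment> \<open>Almost surely exactly one \<open>\<pi>\<close> is induced, so only its term in
    the sum can be nonzero, and its coefficient counts the relabellings for which \<open>E\<close>
    holds.\<close>
  proof (rule integral_cong_AE)
    show "AE pt in M. (\<Sum>\<tau>\<in>?S. indicator {pt \<in> space M. E (pt \<circ> \<tau>)} pt) =
       (\<Sum>\<pi>\<in>?S. real (card {\<tau>. \<tau> permutes {1..n} \<and> E (perm_points \<pi> \<circ> \<tau>)}) *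
      indicator {pt \<in> space M. induces_perm n pt \<pi>} pt)"
      using AE_distinct_coordinates[OF \<mu>, of n, folded M_def] AE_space
    proof eventually_elim
      case (elim pt)
      then have "\<exists>!\<pi>. \<pi> permutes {1..n} \<and> induces_perm n pt \<pi>"
        by (intro ex1_induces_perm) (rule conjunct1 conjunct2, assumption)+
      then obtain \<pi> where *: "\<pi> permutes {1..n} \<and> induces_perm n pt \<pi>"
        and uniq: "\<forall>\<pi>'. \<pi>' permutes {1..n} \<and> induces_perm n pt \<pi>' \<longrightarrow> \<pi>' = \<pi>"
        by (rule ex1E)
      from * have \<pi>: "\<pi> permutes {1..n}" "induces_perm n pt \<pi>" by simp_all
      have "real (card {\<tau>. \<tau> permutes {1..n} \<and> E (perm_points \<pi>' \<circ> \<tau>)}) *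
         indicator {pt \<in> space M. induces_perm n pt \<pi>'} pt =
         (if \<pi>' = \<pi> then real (card {\<tau>. \<tau> permutes {1..n} \<and> E (perm_points \<pi> \<circ> \<tau>)}) else 0)"
        if "\<pi>' \<in> ?S" for \<pi>'
      proof (cases "\<pi>' = \<pi>")
        case True
        then show ?thesis using elim(2) \<pi>(2) by simp
      next
        case False
        then have "\<not> induces_perm n pt \<pi>'" using uniq that by blast
        then show ?thesis using False by simp
      qed
      then have "(\<Sum>\<pi>\<in>?S. real (card {\<tau>. \<tau> permutes {1..n} \<and> E (perm_points \<pi> \<circ> \<tau>)}) *
         indicator {pt \<in> space M. induces_perm n pt \<pi>} pt) =
        (\<Sum>\<pi>'\<in>?S. if \<pi>' = \<pi> then real (card {\<tau>. \<tau> permutes {1..n} \<and> E (perm_points \<pi> \<circ> \<tau>)}) else 0)"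
        by (intro sum.cong refl)
      also have "\<dots> = real (card {\<tau>. \<tau> permutes {1..n} \<and> E (perm_points \<pi> \<circ> \<tau>)})"
        using \<pi>(1) finS by simp
      also have "\<dots> = real (card {\<tau>. \<tau> permutes {1..n} \<and> E (pt \<circ> \<tau>)})"
        by (rule arg_cong[where f = real], rule card_order_invariant[OF \<pi>, of E, symmetric], rule E')
      also have "\<dots> = (\<Sum>\<tau>\<in>?S. if E (pt \<circ> \<tau>) then 1 else 0)"
        using finS by (simp add: sum.If_cases Collect_conj_eq)
      also have "\<dots> = (\<Sum>\<tau>\<in>?S. indicator {pt \<in> space M. E (pt \<circ> \<tau>)} pt)"
        using elim(2) by (intro sum.cong) (auto simp: indicator_def)
      finally show ?case ..
    qed
  qed (use meas invE invP in \<open>auto intro!: borel_measurable_sum borel_measurable_times borel_measurable_indicator\<close>)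
  also have "\<dots> = (\<Sum>\<pi>\<in>?S. \<integral>pt. real (card {\<tau>. \<tau> permutes {1..n} \<and> E (perm_points \<pi> \<circ> \<tau>)}) *
      indicator {pt \<in> space M. induces_perm n pt \<pi>} pt \<partial>M)"
    using meas[OF invP] by (intro Bochner_Integration.integral_sum integrable_mult_right integrable_real_indicator)
      (auto simp: M.emeasure_eq_measure)
  also have "\<dots> = (\<Sum>\<pi>\<in>?S. real (card {\<tau>. \<tau> permutes {1..n} \<and> E (perm_points \<pi> \<circ> \<tau>)}) *
       perm_density (n, \<pi>) \<mu>)"
    using meas[OF invP] by (intro sum.cong) (auto simp: perm_density_def M_def Let_def)
  finally show ?thesis .
qed

section \<open>Distribution functions of permutons\<close>

lemma closed_rect_borel: "{a..b::real} \<times> {c..d::real} \<in> sets borel"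
  by (intro borel_closed closed_Times) auto

lemma permuton_sets_iff:
  assumes "permuton \<mu>"
  shows "A \<in> sets \<mu> \<longleftrightarrow> A \<in> sets borel \<and> A \<subseteq> unit_square"
proof -
  have "unit_square \<inter> space borel \<in> sets borel" using closed_rect_borel by simp
  then show ?thesis using permutonD(2)[OF assms] sets_restrict_space_iff by blast
qed

lemma permuton_cdf_bounds: "permuton \<mu> \<Longrightarrow> 0 \<le> permuton_cdf \<mu> z \<and> permuton_cdf \<mu> z \<le> 1"
  using prob_space.prob_le_1[OF permutonD(1)] by (cases z) (simp add: permuton_cdf_def)

text \<open>The larger rectangle is covered by the smaller one, a vertical strip of mass
  \<open>x' - x\<close> and a horizontal strip of mass \<open>y' - y\<close>.\<close>

lemma permuton_cdf_mono_lipschitz: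
  assumes \<mu>: "permuton \<mu>" and xy: "0 \<le> x" "x \<le> x'" "x' \<le> 1" "0 \<le> y" "y \<le> y'" "y' \<le> 1"
  shows "permuton_cdf \<mu> (x, y) \<le> permuton_cdf \<mu> (x', y')"
    and "permuton_cdf \<mu> (x', y') \<le> permuton_cdf \<mu> (x, y) + (x' - x) + (y' - y)"
proof -
  interpret prob_space \<mu> by (rule permutonD(1)[OF \<mu>])
  have s: "{a..b} \<times> {c..d} \<in> sets \<mu>" if "0 \<le> a" "b \<le> 1" "0 \<le> c" "d \<le> 1" for a b c d
    using that closed_rect_borel by (auto simp: permuton_sets_iff[OF \<mu>])
  show "permuton_cdf \<mu> (x, y) \<le> permuton_cdf \<mu> (x', y')"
    unfolding permuton_cdf_def using xy by (auto intro!: finite_measure_mono s)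
  have "measure \<mu> ({0..x'} \<times> {0..y'}) \<le> measure \<mu> ({0..x} \<times> {0..y} \<union> ({x..x'} \<times> {0..1} \<union> {0..1} \<times> {y..y'}))"
    using xy by (intro finite_measure_mono sets.Un s) auto
  also have "\<dots> \<le> measure \<mu> ({0..x} \<times> {0..y}) + measure \<mu> ({x..x'} \<times> {0..1} \<union> {0..1} \<times> {y..y'})"
    using xy by (intro measure_Un_le sets.Un s) auto
  also have "measure \<mu> ({x..x'} \<times> {0..1} \<union> {0..1} \<times> {y..y'}) \<le>
      measure \<mu> ({x..x'} \<times> {0..1}) + measure \<mu> ({0..1} \<times> {y..y'})"
    using xy by (intro measure_Un_le s) auto
  also have "\<dots> = (x' - x) + (y' - y)" using permutonD(4,5)[OF \<mu>] xy by simp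
  finally show "permuton_cdf \<mu> (x', y') \<le> permuton_cdf \<mu> (x, y) + (x' - x) + (y' - y)"
    by (simp add: permuton_cdf_def)
qed

lemma continuous_on_permuton_cdf:
  assumes \<mu>: "permuton \<mu>"
  shows "continuous_on unit_square (permuton_cdf \<mu>)"
proof -
  have x: "\<bar>permuton_cdf \<mu> (x, y) - permuton_cdf \<mu> (x', y')\<bar> \<le> \<bar>x - x'\<bar> + \<bar>y - y'\<bar>"
    if "(x, y) \<in> unit_square" "(x', y') \<in> unit_square" for x y x' y'
  proof -
    have "permuton_cdf \<mu> (a, b) - permuton_cdf \<mu> (a', b') \<le> \<bar>a - a'\<bar> + \<bar>b - b'\<bar>"
      if "(a, b) \<in> unit_square" "(a', b') \<in> unit_square" for a b a' b'
    proof -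
      \<comment> \<open>The coordinatewise maximum dominates both points, which need not be
        comparable with each other.\<close>
      have "permuton_cdf \<mu> (a, b) \<le> permuton_cdf \<mu> (max a a', max b b')"
        using that by (intro permuton_cdf_mono_lipschitz(1)[OF \<mu>]) auto
      also have "\<dots> \<le> permuton_cdf \<mu> (a', b') + (max a a' - a') + (max b b' - b')"
        using that by (intro permuton_cdf_mono_lipschitz(2)[OF \<mu>]) auto
      finally show ?thesis by linarith
    qed
    from this[of x y x' y'] this[of x' y' x y] that show ?thesis
      by (simp add: abs_minus_commute abs_le_iff)
  qed
  have "2-lipschitz_on unit_square (permuton_cdf \<mu>)"
  proof (rule lipschitz_onI)
    fix z w assume zw: "z \<in> unit_square" "w \<in> unit_square"
    have "\<bar>fst z - fst w\<bar> \<le> dist z w" "\<bar>snd z - snd w\<bar> \<le> dist z w"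
      using dist_fst_le[of z w] dist_snd_le[of z w] by (simp_all add: dist_real_def)
    with x[of "fst z" "snd z" "fst w" "snd w"] zw show "dist (permuton_cdf \<mu> z) (permuton_cdf \<mu> w) \<le> 2 * dist z w"
      by (simp add: dist_real_def)
  qed simp
  then show ?thesis by (rule lipschitz_on_continuous_on)
qed

text \<open>The mass of a lower-left quadrant is zero or a value of the distribution function at a
  corner clipped to the square, and quadrants form an intersection-stable generator. As they live in
  the plane, the images of the measures there are compared first.\<close>

lemma permuton_eqI:
  assumes \<mu>: "permuton \<mu>" and \<nu>: "permuton \<nu>"
    and eq: "\<And>z. z \<in> unit_square \<Longrightarrow> permuton_cdf \<mu> z = permuton_cdf \<nu> z"
  shows "\<mu> = \<nu>"
proof -
  have id: "(\<lambda>z. z) \<in> measurable \<rho> borel" if "permuton \<rho>" for \<rho>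
    by (rule permuton_measurable[OF that]) simp
  have fin: "finite_measure \<rho>" if "permuton \<rho>" for \<rho>
    using permutonD(1)[OF that] by (simp add: prob_space_def)
  have lower: "emeasure (distr \<rho> borel (\<lambda>z. z)) {..(a, b)} =
      (if 0 \<le> a \<and> 0 \<le> b then ennreal (permuton_cdf \<rho> (min a 1, min b 1)) else 0)"
    if \<rho>: "permuton \<rho>" for \<rho> a b
  proof -
    have "emeasure (distr \<rho> borel (\<lambda>z. z)) {..(a, b)} = emeasure \<rho> ({..(a, b)} \<inter> unit_square)"
      using id[OF \<rho>] permutonD(3)[OF \<rho>] by (subst emeasure_distr) auto
    also have "{..(a, b)} \<inter> unit_square = (if 0 \<le> a \<and> 0 \<le> b then {0..min a 1} \<times> {0..min b 1} else {})"
      by (auto simp: less_eq_prod_def)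
    finally show ?thesis
      using finite_measure.emeasure_eq_measure[OF fin[OF \<rho>]] by (simp add: permuton_cdf_def)
  qed
  have "distr \<mu> borel (\<lambda>z. z) = distr \<nu> borel (\<lambda>z. z)"
  proof (rule measure_eqI_generator_eq[where \<Omega> = UNIV and E = "range (\<lambda>a. {..a})"
        and A = "\<lambda>i. {..(real i, real i)}"])
    show "Int_stable (range (\<lambda>a::real \<times> real. {..a}))"
    proof (rule Int_stableI)
      fix A B assume "A \<in> range (\<lambda>a::real \<times> real. {..a})" "B \<in> range (\<lambda>a::real \<times> real. {..a})"
      then obtain a b where "A = {..a}" "B = {..b}" by auto
      then have "A \<inter> B = {..(min (fst a) (fst b), min (snd a) (snd b))}"
        by (auto simp: less_eq_prod_def)
      then show "A \<inter> B \<in> range (\<lambda>a. {..a})" by blast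
    qed
    show "emeasure (distr \<mu> borel (\<lambda>z. z)) X = emeasure (distr \<nu> borel (\<lambda>z. z)) X"
      if X: "X \<in> range (\<lambda>a. {..a})" for X
    proof -
      obtain a b where "X = {..(a, b)}" using X by auto
      then show ?thesis using eq by (simp add: lower[OF \<mu>] lower[OF \<nu>])
    qed
    show "sets (distr \<mu> borel (\<lambda>z. z)) = sigma_sets UNIV (range (\<lambda>a. {..a}))"
      "sets (distr \<nu> borel (\<lambda>z. z)) = sigma_sets UNIV (range (\<lambda>a. {..a}))"
      by (simp_all add: borel_eq_atMost)
    show "(\<Union>i. {..(real i, real i)}) = UNIV"
    proof (intro equalityI subsetI UNIV_I)
      fix z :: "real \<times> real"
      obtain i where "max (fst z) (snd z) \<le> real i" using real_arch_simple by blast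
      then have "z \<in> {..(real i, real i)}" by (simp add: less_eq_prod_def)
      then show "z \<in> (\<Union>i. {..(real i, real i)})" by blast
    qed
    show "emeasure (distr \<mu> borel (\<lambda>z. z)) {..(real i, real i)} \<noteq> \<infinity>" for i
      by (simp add: lower[OF \<mu>])
  qed auto
  then have *: "emeasure (distr \<mu> borel (\<lambda>z. z)) B = emeasure (distr \<nu> borel (\<lambda>z. z)) B" for B by simp
  show ?thesis
  proof (rule measure_eqI)
    show "sets \<mu> = sets \<nu>" using permutonD(2)[OF \<mu>] permutonD(2)[OF \<nu>] by simp
    fix A assume "A \<in> sets \<mu>"
    then have A: "A \<in> sets borel" "A \<subseteq> unit_square"
      by (simp_all add: permuton_sets_iff[OF \<mu>])
    have "emeasure (distr \<rho> borel (\<lambda>z. z)) A = emeasure \<rho> A" if \<rho>: "permuton \<rho>" for \<rho>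
      using id[OF \<rho>] A permutonD(3)[OF \<rho>] by (subst emeasure_distr) (auto simp: Int_absorb2)
    then show "emeasure \<mu> A = emeasure \<nu> A" using * \<mu> \<nu> by metis
  qed
qed

text \<open>The strip condition fixes the distribution function of each marginal, and this
  determines the marginal.\<close>

lemma permuton_marginals:
  assumes \<mu>: "permuton \<mu>"
  shows "distr \<mu> borel fst = uniform_measure lborel {0..1}"
    and "distr \<mu> borel snd = uniform_measure lborel {0..1}"
proof -
  interpret prob_space \<mu> by (rule permutonD(1)[OF \<mu>])
  have m: "fst \<in> borel_measurable \<mu>" "snd \<in> borel_measurable \<mu>"
    by (auto intro!: permuton_measurable[OF \<mu>] borel_measurable_continuous_onI continuous_intros)
  have u: "real_distribution (uniform_measure lborel {0..1::real})"
    by (auto simp: real_distribution_def real_distribution_axioms_def intro!: prob_space_uniform_measure)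
  have cu: "cdf (uniform_measure lborel {0..1}) x = (if x < 0 then 0 else min x 1)" for x :: real
  proof -
    have "{0..1} \<inter> {..x} = (if x < 0 then {} else {0..min x 1})" by auto
    then show ?thesis by (simp add: cdf_def measure_uniform_measure min.commute)
  qed
  have "cdf (distr \<mu> borel fst) x = (if x < 0 then 0 else min x 1)" for x
  proof -
    have "fst -` {..x} \<inter> space \<mu> = (if x < 0 then {} else {0..min x 1} \<times> {0..1})"
      by (auto simp: permutonD(3)[OF \<mu>])
    then show ?thesis using permutonD(4)[OF \<mu>, of 0 "min x 1"] by (simp add: cdf_def measure_distr[OF m(1)])
  qed
  then show "distr \<mu> borel fst = uniform_measure lborel {0..1}"
    by (intro cdf_unique u real_distribution_distr m) (auto simp: cu)
  have "cdf (distr \<mu> borel snd) x = (if x < 0 then 0 else min x 1)" for x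
  proof -
    have "snd -` {..x} \<inter> space \<mu> = (if x < 0 then {} else {0..1} \<times> {0..min x 1})"
      by (auto simp: permutonD(3)[OF \<mu>])
    then show ?thesis using permutonD(5)[OF \<mu>, of 0 "min x 1"] by (simp add: cdf_def measure_distr[OF m(2)])
  qed
  then show "distr \<mu> borel snd = uniform_measure lborel {0..1}"
    by (intro cdf_unique u real_distribution_distr m) (auto simp: cu)
qed

section \<open>Integrals determined by densities\<close>

lemma unit_square_eq_cbox: "unit_square = cbox (0, 0) (1, 1)"
  by (simp add: cbox_Pair_eq)

lemma integrable_on_unit_square:
  fixes f :: "real \<times> real \<Rightarrow> real"
  shows "continuous_on unit_square f \<Longrightarrow> f integrable_on unit_square"
  unfolding unit_square_eq_cbox by (rule integrable_continuous)

text \<open>Whatever the dependence within one sample point, the first coordinate of one and the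
  second coordinate of another are independent and uniform, so their joint law is Lebesgue measure
  on the square.\<close>

lemma nn_integral_permuton_product:
  assumes \<mu>: "permuton \<mu>" and g: "continuous_on unit_square g"
    and nonneg: "\<And>z. z \<in> unit_square \<Longrightarrow> 0 \<le> g z"
  shows "(\<integral>\<^sup>+z1. \<integral>\<^sup>+z2. ennreal (g (fst z1, snd z2)) \<partial>\<mu> \<partial>\<mu>) = ennreal (integral unit_square g)"
proof -
  \<comment> \<open>Extension by zero makes the integrand Borel on the plane and lets uniform
    integrals be taken over the whole line.\<close>
  define k where "k z = ennreal (indicator unit_square z * g z)" for z
  have meas: "(\<lambda>z. indicator unit_square z * g z) \<in> borel_measurable borel"
    using borel_measurable_continuous_on_indicator[OF closed_rect_borel g] by simp
  then have k[measurable]: "k \<in> borel_measurable borel" unfolding k_def[abs_def] by measurable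
  have k': "(\<lambda>z. k z) \<in> borel_measurable (borel \<Otimes>\<^sub>M borel)" using k by (simp add: borel_prod)
  have ky[measurable]: "(\<lambda>y. k (x, y)) \<in> borel_measurable borel" for x
    using k' by measurable
  define K where "K x = (\<integral>\<^sup>+y. k (x, y) \<partial>lborel)" for x
  have K[measurable]: "K \<in> borel_measurable borel"
    unfolding K_def[abs_def]
    using lborel.borel_measurable_nn_integral_fst[of k "borel"] k' by (simp cong: measurable_cong_sets)
  have fst: "fst \<in> borel_measurable \<mu>" and snd: "snd \<in> borel_measurable \<mu>"
    by (auto intro!: permuton_measurable[OF \<mu>] borel_measurable_continuous_onI continuous_intros)
  have U: "(\<integral>\<^sup>+x. f x \<partial>uniform_measure lborel {0..1}) = (\<integral>\<^sup>+x. f x \<partial>lborel)"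
    if [measurable]: "f \<in> borel_measurable borel" and "\<And>x. x \<notin> {0..1} \<Longrightarrow> f x = 0" for f :: "real \<Rightarrow> ennreal"
  proof -
    have "f x * indicator {0..1} x = f x" for x using that(2)[of x] by (cases "x \<in> {0..1}") simp_all
    then show ?thesis by (subst nn_integral_uniform_measure) (simp_all add: divide_ennreal_def)
  qed
  have inner: "(\<integral>\<^sup>+z2. ennreal (g (fst z1, snd z2)) \<partial>\<mu>) = K (fst z1)" if "z1 \<in> space \<mu>" for z1
  proof -
    have "(\<integral>\<^sup>+z2. ennreal (g (fst z1, snd z2)) \<partial>\<mu>) = (\<integral>\<^sup>+z2. k (fst z1, snd z2) \<partial>\<mu>)"
      using that by (intro nn_integral_cong) (auto simp: k_def permutonD(3)[OF \<mu>])
    also have "\<dots> = (\<integral>\<^sup>+y. k (fst z1, y) \<partial>distr \<mu> borel snd)"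
      by (subst nn_integral_distr[OF snd]) simp_all
    also have "\<dots> = K (fst z1)"
      unfolding permuton_marginals(2)[OF \<mu>] K_def by (rule U[OF ky]) (auto simp: k_def)
    finally show ?thesis .
  qed
  have "(\<integral>\<^sup>+z1. \<integral>\<^sup>+z2. ennreal (g (fst z1, snd z2)) \<partial>\<mu> \<partial>\<mu>) = (\<integral>\<^sup>+z1. K (fst z1) \<partial>\<mu>)"
    using inner by (intro nn_integral_cong) auto
  also have "\<dots> = (\<integral>\<^sup>+x. K x \<partial>distr \<mu> borel fst)"
    by (subst nn_integral_distr[OF fst]) simp_all
  also have "\<dots> = (\<integral>\<^sup>+x. K x \<partial>lborel)"
    unfolding permuton_marginals(1)[OF \<mu>] by (rule U[OF K]) (auto simp: K_def k_def)
  also have "\<dots> = (\<integral>\<^sup>+z. k z \<partial>(lborel \<Otimes>\<^sub>M lborel))"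
    unfolding K_def by (rule lborel.nn_integral_fst) (use k in \<open>simp add: lborel_prod\<close>)
  also have "\<dots> = (\<integral>\<^sup>+z. ennreal (indicator unit_square z * g z) \<partial>lborel)"
    by (simp add: lborel_prod k_def)
  also have "\<dots> = ennreal (\<integral>z. indicator unit_square z * g z \<partial>lborel)"
    using borel_integrable_compact[OF _ g] nonneg
    by (intro nn_integral_eq_integral) (auto simp: compact_Times indicator_def intro!: AE_I2)
  also have "(\<integral>z. indicator unit_square z * g z \<partial>lborel) = integral unit_square g"
    using set_borel_integral_eq_integral(2)[of unit_square g] borel_integrable_compact[OF _ g]
    by (simp add: compact_Times set_integrable_def set_lebesgue_integral_def)
  finally show ?thesis .
qed

text \<open>The probability that a random point satisfies the chosen constraints: \<open>U\<close>
  bounds its first coordinate by that of \<open>z\<close>, and \<open>V\<close> its second.\<close>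

definition corner :: "(real \<times> real) measure \<Rightarrow> bool \<Rightarrow> bool \<Rightarrow> real \<times> real \<Rightarrow> real" where
  "corner \<mu> U V z =
     (if U then if V then permuton_cdf \<mu> z else fst z else if V then snd z else 1)"

lemma corner_nonneg: "permuton \<mu> \<Longrightarrow> z \<in> unit_square \<Longrightarrow> 0 \<le> corner \<mu> U V z"
  using permuton_cdf_bounds by (auto simp: corner_def)

lemma continuous_on_corner: "permuton \<mu> \<Longrightarrow> continuous_on unit_square (corner \<mu> U V)"
  unfolding corner_def[abs_def]
  by (cases U; cases V) (auto intro!: continuous_intros continuous_on_permuton_cdf)

lemma emeasure_corner:
  assumes \<mu>: "permuton \<mu>" and xy: "(x, y) \<in> unit_square"
  shows "{z \<in> space \<mu>. (U \<longrightarrow> fst z \<le> x) \<and> (V \<longrightarrow> snd z \<le> y)} \<in> sets \<mu>"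
    and "emeasure \<mu> {z \<in> space \<mu>. (U \<longrightarrow> fst z \<le> x) \<and> (V \<longrightarrow> snd z \<le> y)} = ennreal (corner \<mu> U V (x, y))"
proof -
  interpret prob_space \<mu> by (rule permutonD(1)[OF \<mu>])
  \<comment> \<open>An absent constraint amounts to the bound \<open>1\<close>.\<close>
  have *: "{z \<in> space \<mu>. (U \<longrightarrow> fst z \<le> x) \<and> (V \<longrightarrow> snd z \<le> y)} =
      {0..(if U then x else 1)} \<times> {0..(if V then y else 1)}"
    using xy by (auto simp: permutonD(3)[OF \<mu>])
  show "{z \<in> space \<mu>. (U \<longrightarrow> fst z \<le> x) \<and> (V \<longrightarrow> snd z \<le> y)} \<in> sets \<mu>"
    unfolding * permuton_sets_iff[OF \<mu>] using xy closed_rect_borel by auto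
  show "emeasure \<mu> {z \<in> space \<mu>. (U \<longrightarrow> fst z \<le> x) \<and> (V \<longrightarrow> snd z \<le> y)} = ennreal (corner \<mu> U V (x, y))"
    unfolding * emeasure_eq_measure
    using xy permutonD(4)[OF \<mu>, of 0 1] permutonD(4)[OF \<mu>, of 0 x] permutonD(5)[OF \<mu>, of 0 y]
    by (auto simp: corner_def permuton_cdf_def)
qed

text \<open>The first coordinate of point \<open>1\<close> and the second coordinate of point \<open>2\<close> are independent and
  uniform, and given these each remaining point satisfies its constraint with probability
  \<^const>\<open>corner\<close>.\<close>

lemma prob_corner_event:
  fixes u v :: "nat \<Rightarrow> bool" and n :: nat
  assumes \<mu>: "permuton \<mu>"
  defines "E \<equiv> \<lambda>pt. \<forall>i\<in>{3..n + 2}. (u i \<longrightarrow> fst (pt i) \<le> fst (pt 1)) \<and> (v i \<longrightarrow> snd (pt i) \<le> snd (pt 2))"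
  defines "M \<equiv> PiM {1..n + 2} (\<lambda>_. \<mu>)"
  shows "order_invariant (n + 2) E"
    and "measure M {pt \<in> space M. E pt} = integral unit_square (\<lambda>z. \<Prod>i\<in>{3..n + 2}. corner \<mu> (u i) (v i) z)"
proof -
  show inv: "order_invariant (n + 2) E"
    unfolding order_invariant_def order_type_eq_iff
  proof (intro allI impI)
    fix pt pt' :: "nat \<Rightarrow> real \<times> real"
    assume *: "\<forall>i\<in>{1..n + 2}. \<forall>j\<in>{1..n + 2}. (fst (pt i) < fst (pt j) \<longleftrightarrow> fst (pt' i) < fst (pt' j)) \<and>
        (snd (pt i) < snd (pt j) \<longleftrightarrow> snd (pt' i) < snd (pt' j))"
    \<comment> \<open>A weak inequality is the negation of the reversed strict one, which the order
      type records.\<close>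
    have "(fst (pt i) \<le> fst (pt 1) \<longleftrightarrow> fst (pt' i) \<le> fst (pt' 1)) \<and>
        (snd (pt i) \<le> snd (pt 2) \<longleftrightarrow> snd (pt' i) \<le> snd (pt' 2))" if "i \<in> {3..n + 2}" for i
      using *[rule_format, of 1 i] *[rule_format, of 2 i] that by (simp flip: not_less)
    then show "E pt = E pt'" unfolding E_def by blast
  qed
  interpret prob_space \<mu> by (rule permutonD(1)[OF \<mu>])
  interpret product_sigma_finite "\<lambda>_::nat. \<mu>" ..
  interpret M: prob_space M unfolding M_def by (intro prob_space_PiM) unfold_locales
  define I where "I = {3..n + 2}"
  define A where "A = {pt \<in> space M. E pt}"
  have set: "{1..n + 2} = insert 1 (insert 2 I)" "finite I" "1 \<notin> insert 2 I" "2 \<notin> I"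
    by (auto simp: I_def)
  have A: "A \<in> sets M" using order_invariant_measurable[OF \<mu> inv] by (simp add: M_def A_def pred_def)
  define g where "g z = (\<Prod>i\<in>I. corner \<mu> (u i) (v i) z)" for z
  have A1: "indicator A \<in> borel_measurable (PiM (insert 1 (insert 2 I)) (\<lambda>_. \<mu>))"
    using borel_measurable_indicator[OF A] unfolding M_def set(1) .
  have A2: "(\<lambda>x. indicator A (x(1 := z))) \<in> borel_measurable (PiM (insert 2 I) (\<lambda>_. \<mu>))"
    if "z \<in> space \<mu>" for z
  proof (rule measurable_compose[OF _ A1])
    show "(\<lambda>x. x(1 := z)) \<in> measurable (PiM (insert 2 I) (\<lambda>_. \<mu>)) (PiM (insert 1 (insert 2 I)) (\<lambda>_. \<mu>))"
      using that by (intro measurable_fun_upd[where J = "insert 2 I"]) auto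
  qed
  have inner: "(\<integral>\<^sup>+x. indicator A (x(2 := z2, 1 := z1)) \<partial>PiM I (\<lambda>_. \<mu>)) = ennreal (g (fst z1, snd z2))"
    if z: "z1 \<in> space \<mu>" "z2 \<in> space \<mu>" for z1 z2
  proof -
    have sq: "(fst z1, snd z2) \<in> unit_square" using z by (auto simp: permutonD(3)[OF \<mu>])
    let ?B = "\<lambda>i. {z \<in> space \<mu>. (u i \<longrightarrow> fst z \<le> fst z1) \<and> (v i \<longrightarrow> snd z \<le> snd z2)}"
    \<comment> \<open>With points \<open>1\<close> and \<open>2\<close> fixed, the remaining
      constraints form a product set.\<close>
    have *: "x(2 := z2, 1 := z1) \<in> A \<longleftrightarrow> x \<in> PiE I ?B" if x: "x \<in> space (PiM I (\<lambda>_. \<mu>))" for x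
    proof -
      have "x(2 := z2, 1 := z1) \<in> space M"
        using x z unfolding M_def set(1) space_PiM by (intro PiE_fun_upd)
      moreover have "E (x(2 := z2, 1 := z1)) \<longleftrightarrow> (\<forall>i\<in>I. (u i \<longrightarrow> fst (x i) \<le> fst z1) \<and> (v i \<longrightarrow> snd (x i) \<le> snd z2))"
        unfolding E_def I_def[symmetric] by (intro ball_cong refl) (auto simp: I_def)
      moreover have "x \<in> PiE I ?B \<longleftrightarrow> (\<forall>i\<in>I. (u i \<longrightarrow> fst (x i) \<le> fst z1) \<and> (v i \<longrightarrow> snd (x i) \<le> snd z2))"
        using x unfolding space_PiM PiE_iff by blast
      ultimately show ?thesis by (simp add: A_def)
    qed
    have "(\<integral>\<^sup>+x. indicator A (x(2 := z2, 1 := z1)) \<partial>PiM I (\<lambda>_. \<mu>)) =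
        (\<integral>\<^sup>+x. indicator (PiE I ?B) x \<partial>PiM I (\<lambda>_. \<mu>))"
      using * by (intro nn_integral_cong) (simp add: indicator_def)
    also have "\<dots> = emeasure (PiM I (\<lambda>_. \<mu>)) (PiE I ?B)"
      using emeasure_corner(1)[OF \<mu> sq] set(2) by (intro nn_integral_indicator sets_PiM_I_finite)
    also have "\<dots> = (\<Prod>i\<in>I. emeasure \<mu> (?B i))"
      using emeasure_corner(1)[OF \<mu> sq] set(2) by (intro emeasure_PiM)
    also have "\<dots> = (\<Prod>i\<in>I. ennreal (corner \<mu> (u i) (v i) (fst z1, snd z2)))"
      by (simp only: emeasure_corner(2)[OF \<mu> sq])
    also have "\<dots> = ennreal (g (fst z1, snd z2))"
      unfolding g_def using corner_nonneg[OF \<mu> sq] by (intro prod_ennreal)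
    finally show ?thesis .
  qed
  have "emeasure M A = (\<integral>\<^sup>+pt. indicator A pt \<partial>M)" by (rule nn_integral_indicator[symmetric]) (rule A)
  \<comment> \<open>Points \<open>1\<close> and \<open>2\<close> are split off so that the others
    are integrated first, against a fixed corner.\<close>
  also have "\<dots> = (\<integral>\<^sup>+z1. \<integral>\<^sup>+x. indicator A (x(1 := z1)) \<partial>PiM (insert 2 I) (\<lambda>_. \<mu>) \<partial>\<mu>)"
    unfolding M_def set(1) by (rule product_nn_integral_insert_rev[OF _ set(3) A1]) (simp add: set(2))
  also have "\<dots> = (\<integral>\<^sup>+z1. \<integral>\<^sup>+z2. \<integral>\<^sup>+x. indicator A (x(2 := z2, 1 := z1)) \<partial>PiM I (\<lambda>_. \<mu>) \<partial>\<mu> \<partial>\<mu>)"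
    by (intro nn_integral_cong product_nn_integral_insert_rev[OF set(2,4) A2])
  also have "\<dots> = (\<integral>\<^sup>+z1. \<integral>\<^sup>+z2. ennreal (g (fst z1, snd z2)) \<partial>\<mu> \<partial>\<mu>)"
    by (intro nn_integral_cong inner)
  also have "\<dots> = ennreal (integral unit_square g)"
    unfolding g_def using continuous_on_corner[OF \<mu>] corner_nonneg[OF \<mu>]
    by (intro nn_integral_permuton_product[OF \<mu>] continuous_on_prod prod_nonneg)
  finally have "emeasure M A = ennreal (integral unit_square g)" .
  moreover have "0 \<le> integral unit_square g"
    unfolding g_def using corner_nonneg[OF \<mu>] continuous_on_corner[OF \<mu>]
    by (intro integral_nonneg integrable_on_unit_square continuous_on_prod prod_nonneg)
  ultimately have "measure M A = integral unit_square g" by (simp add: measure_def)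
  then show "measure M {pt \<in> space M. E pt} = integral unit_square (\<lambda>z. \<Prod>i\<in>{3..n + 2}. corner \<mu> (u i) (v i) z)"
    unfolding A_def g_def[abs_def] I_def .
qed

text \<open>Points \<open>1\<close> and \<open>2\<close> supply a uniform corner
  \<open>(x, y)\<close>; each further point contributes a factor \<open>x\<close>, \<open>y\<close>
  or \<open>F(x, y)\<close>, according to the constraints imposed on it.\<close>

lemma monomial_integral_forced:
  assumes "permuton \<mu>" "permuton \<nu>"
    and eq: "\<And>\<pi>. \<pi> permutes {1..a + b + c + 2} \<Longrightarrow>
      perm_density (a + b + c + 2, \<pi>) \<mu> = perm_density (a + b + c + 2, \<pi>) \<nu>"
  shows "integral unit_square (\<lambda>z. fst z ^ a * snd z ^ b * permuton_cdf \<mu> z ^ c) =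
    integral unit_square (\<lambda>z. fst z ^ a * snd z ^ b * permuton_cdf \<nu> z ^ c)"
proof -
  \<comment> \<open>From index \<open>3\<close> on there are blocks of \<open>a\<close>,
    \<open>b\<close> and \<open>c\<close> points, constrained in the first coordinate, the second,
    and both.\<close>
  define u where "u i \<longleftrightarrow> i < 3 + a \<or> 3 + a + b \<le> i" for i
  define v where "v i \<longleftrightarrow> 3 + a \<le> i" for i
  have prod: "(\<Prod>i\<in>{3..a + b + c + 2}. corner \<rho> (u i) (v i) z) = fst z ^ a * snd z ^ b * permuton_cdf \<rho> z ^ c"
    for \<rho> z
  proof -
    have "{3..a + b + c + 2} = {3..<3 + a + b + c}" by auto
    then have "(\<Prod>i\<in>{3..a + b + c + 2}. corner \<rho> (u i) (v i) z) =
      (\<Prod>i\<in>{3..<3 + a}. corner \<rho> (u i) (v i) z) * (\<Prod>i\<in>{3 + a..<3 + a + b}. corner \<rho> (u i) (v i) z) *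
      (\<Prod>i\<in>{3 + a + b..<3 + a + b + c}. corner \<rho> (u i) (v i) z)"
      by (simp only: prod.atLeastLessThan_concat le_add1 order.trans[OF le_add1 le_add1])
    also have "(\<Prod>i\<in>{3..<3 + a}. corner \<rho> (u i) (v i) z) = (\<Prod>i\<in>{3..<3 + a}. fst z)"
      by (intro prod.cong) (auto simp: corner_def u_def v_def)
    also have "(\<Prod>i\<in>{3 + a..<3 + a + b}. corner \<rho> (u i) (v i) z) = (\<Prod>i\<in>{3 + a..<3 + a + b}. snd z)"
      by (intro prod.cong) (auto simp: corner_def u_def v_def)
    also have "(\<Prod>i\<in>{3 + a + b..<3 + a + b + c}. corner \<rho> (u i) (v i) z) = (\<Prod>i\<in>{3 + a + b..<3 + a + b + c}. permuton_cdf \<rho> z)"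
      by (intro prod.cong) (auto simp: corner_def u_def v_def)
    finally show ?thesis by simp
  qed
  define E where "E = (\<lambda>pt :: nat \<Rightarrow> real \<times> real. \<forall>i\<in>{3..a + b + c + 2}.
     (u i \<longrightarrow> fst (pt i) \<le> fst (pt 1)) \<and> (v i \<longrightarrow> snd (pt i) \<le> snd (pt 2)))"
  \<comment> \<open>The coefficients on the right do not depend on \<open>\<rho>\<close>.\<close>
  have *: "fact (a + b + c + 2) * integral unit_square (\<lambda>z. fst z ^ a * snd z ^ b * permuton_cdf \<rho> z ^ c) =
     (\<Sum>\<pi> | \<pi> permutes {1..a + b + c + 2}.
        real (card {\<tau>. \<tau> permutes {1..a + b + c + 2} \<and> E (perm_points \<pi> \<circ> \<tau>)}) *
        perm_density (a + b + c + 2, \<pi>) \<rho>)" if \<rho>: "permuton \<rho>" for \<rho>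
    using prob_order_event[OF \<rho> prob_corner_event(1)[OF \<rho>, of "a + b + c" u v]]
      prob_corner_event(2)[OF \<rho>, of "a + b + c" u v]
    unfolding prod E_def by simp
  have "fact (a + b + c + 2) * integral unit_square (\<lambda>z. fst z ^ a * snd z ^ b * permuton_cdf \<mu> z ^ c) =
    fact (a + b + c + 2) * integral unit_square (\<lambda>z. fst z ^ a * snd z ^ b * permuton_cdf \<nu> z ^ c)"
    unfolding *[OF assms(1)] *[OF assms(2)] using eq by (intro sum.cong) auto
  then show ?thesis by (rule mult_left_cancel[OF fact_nonzero, THEN iffD1])
qed

lemma integral_unit_square_eq_0_iff:
  assumes "continuous_on unit_square f" "\<And>z. z \<in> unit_square \<Longrightarrow> 0 \<le> f z"
  shows "integral unit_square f = 0 \<longleftrightarrow> (\<forall>z\<in>unit_square. f z = (0::real))"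
proof -
  have "box (0, 0) (1, 1 :: real) \<noteq> ({} :: (real \<times> real) set)"
    by (simp add: box_ne_empty Basis_prod_def)
  then show ?thesis
    using assms unfolding unit_square_eq_cbox by (intro integral_cbox_eq_0_iff)
qed

section \<open>From monomials to polynomials in the coordinates and the distribution
  function\<close>

text \<open>Lists may repeat exponents, so a sum is a concatenation and a product is the list of all
  pairwise products.\<close>

lemma real_polynomial_function_monomials:
  fixes f :: "(real \<times> real) \<times> real \<Rightarrow> real"
  assumes "real_polynomial_function f"
  shows "\<exists>ms. \<forall>x y t. f ((x, y), t) = (\<Sum>(k, a, b, c)\<leftarrow>ms. k * (x ^ a * y ^ b * t ^ c))"
  using assms
proof induction
  case (linear f)
  have "f ((x, y), t) = (\<Sum>(k, a, b, c)\<leftarrow>[(f ((1, 0), 0), 1, 0, 0), (f ((0, 1), 0), 0, 1, 0), (f ((0, 0), 1), 0, 0, 1)].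
      k * (x ^ a * y ^ b * t ^ c))" for x y t
  proof -
    have "((x, y), t) = x *\<^sub>R ((1, 0), 0) + y *\<^sub>R ((0, 1), 0) + t *\<^sub>R ((0, 0), 1)" by simp
    then have "f ((x, y), t) = x *\<^sub>R f ((1, 0), 0) + y *\<^sub>R f ((0, 1), 0) + t *\<^sub>R f ((0, 0), 1)"
      using bounded_linear.linear[OF linear] by (simp only: linear_add linear_cmul)
    then show ?thesis by simp
  qed
  then show ?case by blast
next
  case (const k)
  have "k = (\<Sum>(k, a, b, c)\<leftarrow>[(k, 0, 0, 0)]. k * (x ^ a * y ^ b * t ^ c))" for x y t :: real by simp
  then show ?case by blast
next
  case (add f g)
  then obtain ms ns where "\<forall>x y t. f ((x, y), t) = (\<Sum>(k, a, b, c)\<leftarrow>ms. k * (x ^ a * y ^ b * t ^ c))"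
    "\<forall>x y t. g ((x, y), t) = (\<Sum>(k, a, b, c)\<leftarrow>ns. k * (x ^ a * y ^ b * t ^ c))" by blast
  then have "\<forall>x y t. f ((x, y), t) + g ((x, y), t) = (\<Sum>(k, a, b, c)\<leftarrow>ms @ ns. k * (x ^ a * y ^ b * t ^ c))"
    by simp
  then show ?case by blast
next
  case (mult f g)
  then obtain ms ns where f: "\<forall>x y t. f ((x, y), t) = (\<Sum>(k, a, b, c)\<leftarrow>ms. k * (x ^ a * y ^ b * t ^ c))"
    and g: "\<forall>x y t. g ((x, y), t) = (\<Sum>(k, a, b, c)\<leftarrow>ns. k * (x ^ a * y ^ b * t ^ c))" by blast
  define prods where "prods m = map (\<lambda>(k, a, b, c). (fst m * k, fst (snd m) + a, fst (snd (snd m)) + b, snd (snd (snd m)) + c)) ns"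
    for m :: "real \<times> nat \<times> nat \<times> nat"
  have 1: "(\<Sum>(k, a, b, c)\<leftarrow>prods (k', a', b', c'). k * (x ^ a * y ^ b * t ^ c)) =
     k' * (x ^ a' * y ^ b' * t ^ c') * (\<Sum>(k, a, b, c)\<leftarrow>ns. k * (x ^ a * y ^ b * t ^ c))"
    for x y t :: real and k' a' b' c'
    unfolding prods_def by (induction ns) (auto simp: power_add algebra_simps)
  have "(\<Sum>(k, a, b, c)\<leftarrow>ms. k * (x ^ a * y ^ b * t ^ c)) * (\<Sum>(k, a, b, c)\<leftarrow>ns. k * (x ^ a * y ^ b * t ^ c)) =
     (\<Sum>(k, a, b, c)\<leftarrow>concat (map prods ms). k * (x ^ a * y ^ b * t ^ c))" for x y t :: real
    by (induction ms) (auto simp: 1 distrib_right)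
  with f g have "\<forall>x y t. f ((x, y), t) * g ((x, y), t) =
     (\<Sum>(k, a, b, c)\<leftarrow>concat (map prods ms). k * (x ^ a * y ^ b * t ^ c))" by simp
  then show ?case by blast
qed

text \<open>Asking for all orders up to \<open>N\<close> makes the condition monotone, so finitely
  many such requirements merge into one.\<close>

definition densities_agree :: "nat \<Rightarrow> (real \<times> real) measure \<Rightarrow> (real \<times> real) measure \<Rightarrow> bool" where
  "densities_agree N \<mu> \<nu> \<longleftrightarrow>
     (\<forall>n\<le>N. \<forall>\<pi>. \<pi> permutes {1..n} \<longrightarrow> perm_density (n, \<pi>) \<mu> = perm_density (n, \<pi>) \<nu>)"

text \<open>Linearity over the monomials of \<open>f\<close>; the bound \<open>N\<close> depends on
  \<open>f\<close> only, not on the permutons.\<close>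

lemma polynomial_integral_forced:
  assumes "real_polynomial_function f"
  shows "\<exists>N. \<forall>\<mu> \<nu>. permuton \<mu> \<longrightarrow> permuton \<nu> \<longrightarrow> densities_agree N \<mu> \<nu> \<longrightarrow>
    integral unit_square (\<lambda>z. f (z, permuton_cdf \<mu> z)) = integral unit_square (\<lambda>z. f (z, permuton_cdf \<nu> z))"
proof -
  obtain ms where ms: "\<And>x y t. f ((x, y), t) = (\<Sum>(k, a, b, c)\<leftarrow>ms. k * (x ^ a * y ^ b * t ^ c))"
    using real_polynomial_function_monomials[OF assms] by blast
  have f: "f (z, t) = (\<Sum>(k, a, b, c)\<leftarrow>ms. k * (fst z ^ a * snd z ^ b * t ^ c))" for z t
    using ms[of "fst z" "snd z"] by simp
  \<comment> \<open>The sum of the orders is a convenient upper bound for each of them.\<close>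
  define N where "N = (\<Sum>(k, a, b, c)\<leftarrow>ms. a + b + c + 2)"
  have N: "a + b + c + 2 \<le> N" if "(k, a, b, c) \<in> set ms" for k a b c
    using member_le_sum_list[of "a + b + c + 2" "map (\<lambda>(k, a, b, c). a + b + c + 2) ms"] that
    by (force simp: N_def)
  have int: "(\<lambda>z. k * (fst z ^ a * snd z ^ b * permuton_cdf \<rho> z ^ c)) integrable_on unit_square"
    if "permuton \<rho>" for \<rho> k a b c
    using that by (intro integrable_on_unit_square continuous_intros continuous_on_permuton_cdf)
  have sum: "integral unit_square (\<lambda>z. \<Sum>(k, a, b, c)\<leftarrow>ns. k * (fst z ^ a * snd z ^ b * permuton_cdf \<rho> z ^ c)) =
      (\<Sum>(k, a, b, c)\<leftarrow>ns. k * integral unit_square (\<lambda>z. fst z ^ a * snd z ^ b * permuton_cdf \<rho> z ^ c)) \<and>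
    (\<lambda>z. \<Sum>(k, a, b, c)\<leftarrow>ns. k * (fst z ^ a * snd z ^ b * permuton_cdf \<rho> z ^ c)) integrable_on unit_square"
    if \<rho>: "permuton \<rho>" for \<rho> ns
  proof (induction ns)
    case (Cons m ns)
    obtain k a b c where m: "m = (k, a, b, c)" by (cases m)
    show ?case
      using Cons int[OF \<rho>, of k a b c] by (simp add: m integral_add integrable_add)
  qed (simp add: integrable_on_unit_square)
  show ?thesis
  proof (intro exI[of _ N] allI impI)
    fix \<mu> \<nu> assume *: "permuton \<mu>" "permuton \<nu>" "densities_agree N \<mu> \<nu>"
    have "(\<Sum>(k, a, b, c)\<leftarrow>ms. k * integral unit_square (\<lambda>z. fst z ^ a * snd z ^ b * permuton_cdf \<mu> z ^ c)) =
       (\<Sum>(k, a, b, c)\<leftarrow>ms. k * integral unit_square (\<lambda>z. fst z ^ a * snd z ^ b * permuton_cdf \<nu> z ^ c))"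
    proof (intro arg_cong[where f = sum_list] map_cong refl)
      fix m assume "m \<in> set ms"
      moreover obtain k a b c where m: "m = (k, a, b, c)" by (cases m)
      ultimately have "integral unit_square (\<lambda>z. fst z ^ a * snd z ^ b * permuton_cdf \<mu> z ^ c) =
        integral unit_square (\<lambda>z. fst z ^ a * snd z ^ b * permuton_cdf \<nu> z ^ c)"
        using * N by (intro monomial_integral_forced) (auto simp: densities_agree_def)
      then show "(case m of (k, a, b, c) \<Rightarrow> k * integral unit_square (\<lambda>z. fst z ^ a * snd z ^ b * permuton_cdf \<mu> z ^ c)) =
        (case m of (k, a, b, c) \<Rightarrow> k * integral unit_square (\<lambda>z. fst z ^ a * snd z ^ b * permuton_cdf \<nu> z ^ c))"
        by (simp add: m)
    qed
    then show "integral unit_square (\<lambda>z. f (z, permuton_cdf \<mu> z)) = integral unit_square (\<lambda>z. f (z, permuton_cdf \<nu> z))"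
      unfolding f using sum[OF *(1), of ms] sum[OF *(2), of ms] by simp
  qed
qed

text \<open>If all densities agreed, \<open>r * D\<close> would integrate to zero for every
  polynomial \<open>r\<close>; but for \<open>r\<close> close to \<open>D\<close> the integral is
  close to that of the square of \<open>D\<close>, which is positive.\<close>

lemma permutons_separated:
  assumes \<mu>: "permuton \<mu>" and \<nu>: "permuton \<nu>" and ne: "\<nu> \<noteq> \<mu>"
  shows "\<exists>N. \<not> densities_agree N \<mu> \<nu>"
proof -
  define D where "D z = permuton_cdf \<nu> z - permuton_cdf \<mu> z" for z
  have D: "continuous_on unit_square D"
    unfolding D_def[abs_def] by (intro continuous_intros continuous_on_permuton_cdf \<mu> \<nu>)
  have D1: "\<bar>D z\<bar> \<le> 1" for z
    using permuton_cdf_bounds[OF \<mu>, of z] permuton_cdf_bounds[OF \<nu>, of z] by (simp add: D_def abs_le_iff)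
  define I where "I = integral unit_square (\<lambda>z. D z ^ 2)"
  have cI: "continuous_on unit_square (\<lambda>z. D z ^ 2)" by (intro continuous_intros D)
  have "\<not> (\<forall>z\<in>unit_square. D z ^ 2 = 0)"
  proof
    assume "\<forall>z\<in>unit_square. D z ^ 2 = 0"
    then have "permuton_cdf \<nu> z = permuton_cdf \<mu> z" if "z \<in> unit_square" for z
      using that by (auto simp: D_def)
    then show False using permuton_eqI[OF \<nu> \<mu>] ne by blast
  qed
  then have "I \<noteq> 0"
    using integral_unit_square_eq_0_iff[OF cI] unfolding I_def by simp
  moreover have "0 \<le> I" unfolding I_def by (intro integral_nonneg integrable_on_unit_square cI) simp
  ultimately have I: "0 < I" by simp
  \<comment> \<open>As \<open>D\<close> is bounded by \<open>1\<close>, an error below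
    \<open>I / 2\<close> in \<open>r\<close> costs at most \<open>I / 2\<close> of the integral
    \<open>I\<close>.\<close>
  obtain r where r: "real_polynomial_function r" "\<And>z. z \<in> unit_square \<Longrightarrow> \<bar>D z - r z\<bar> < I / 2"
    using Stone_Weierstrass_real_polynomial_function[OF _ D, of "I / 2"] I by (auto simp: compact_Times)
  have rc: "continuous_on unit_square r"
    using r(1) by (intro continuous_on_polymonial_function) (simp add: real_polynomial_function_eq)
  have "real_polynomial_function (\<lambda>w :: (real \<times> real) \<times> real. (r \<circ> fst) w * snd w)"
    by (intro real_polynomial_function.intros(4) real_polynomial_function_compose r(1)
        polynomial_function_bounded_linear real_polynomial_function.intros(1) bounded_linear_fst bounded_linear_snd)
  from polynomial_integral_forced[OF this] obtain N where N:
    "\<forall>\<mu> \<nu>. permuton \<mu> \<longrightarrow> permuton \<nu> \<longrightarrow> densities_agree N \<mu> \<nu> \<longrightarrow>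
      integral unit_square (\<lambda>z. r z * permuton_cdf \<mu> z) = integral unit_square (\<lambda>z. r z * permuton_cdf \<nu> z)"
    by auto
  have "\<not> densities_agree N \<mu> \<nu>"
  proof
    assume *: "densities_agree N \<mu> \<nu>"
    have int: "(\<lambda>z. r z * permuton_cdf \<rho> z) integrable_on unit_square" if "permuton \<rho>" for \<rho>
      by (intro integrable_on_unit_square continuous_intros rc continuous_on_permuton_cdf that)
    have "integral unit_square (\<lambda>z. r z * D z) = 0"
      using N[rule_format, OF \<mu> \<nu> *] integral_diff[OF int[OF \<nu>] int[OF \<mu>]] by (simp add: D_def algebra_simps)
    moreover have "integral unit_square (\<lambda>z. D z ^ 2 - I / 2) \<le> integral unit_square (\<lambda>z. r z * D z)"
    proof (rule integral_le)
      show "D z ^ 2 - I / 2 \<le> r z * D z" if "z \<in> unit_square" for z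
      proof -
        have "(D z - r z) * D z \<le> \<bar>D z - r z\<bar> * \<bar>D z\<bar>" by (simp flip: abs_mult)
        also have "\<dots> \<le> I / 2 * 1" using r(2)[OF that] D1 I by (intro mult_mono) auto
        finally show ?thesis by (simp add: algebra_simps power2_eq_square)
      qed
    qed (intro integrable_on_unit_square continuous_intros D rc)+
    moreover have "integral unit_square (\<lambda>z. D z ^ 2 - I / 2) = I - I / 2"
      using integrable_on_unit_square[OF cI]
      by (subst integral_diff) (auto simp: I_def unit_square_eq_cbox content_Pair)
    ultimately show False using I by simp
  qed
  then show ?thesis ..
qed

section \<open>Forcing\<close>

text \<open>A permuton of this kind is determined by its values on \<open>T\<close>, and each value
  is taken from a finite list.\<close>

lemma finitely_many_selection_permutons:
  assumes "finite P" "\<And>p. p \<in> P \<Longrightarrow> real_polynomial_function p"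
  shows "finite {\<nu>. permuton \<nu> \<and> selection P unit_square (permuton_cdf \<nu>)}" (is "finite ?C")
proof -
  obtain T where T: "finite T" "T \<subseteq> unit_square"
    "\<forall>F G. selection P unit_square F \<longrightarrow> selection P unit_square G \<longrightarrow>
       (\<forall>z\<in>T. F z = G z) \<longrightarrow> (\<forall>z\<in>unit_square. F z = G z)"
    using finite_determining_set[OF assms] by blast
  have "inj_on (\<lambda>\<nu>. restrict (permuton_cdf \<nu>) T) ?C"
  proof (rule inj_onI)
    fix \<mu> \<nu>
    assume \<mu>: "\<mu> \<in> ?C" and \<nu>: "\<nu> \<in> ?C"
      and eq: "restrict (permuton_cdf \<mu>) T = restrict (permuton_cdf \<nu>) T"
    have "permuton_cdf \<mu> z = permuton_cdf \<nu> z" if "z \<in> T" for z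
      using fun_cong[OF eq, of z] that by simp
    then show "\<mu> = \<nu>" using \<mu> \<nu> T(3) by (intro permuton_eqI) blast+
  qed
  moreover have sub: "(\<lambda>\<nu>. restrict (permuton_cdf \<nu>) T) ` ?C \<subseteq> PiE T (\<lambda>z. (\<lambda>p. p z) ` P)"
    using T(2) by (auto simp: selection_def restrict_PiE_iff)
  moreover have "finite (PiE T (\<lambda>z. (\<lambda>p. p z) ` P))" using T(1) assms(1) by (intro finite_PiE) auto
  ultimately show ?thesis by (intro finite_imageD[OF finite_subset[OF sub]])
qed

lemma selection_forced:
  assumes "permuton \<mu>" "finite P" "\<And>p. p \<in> P \<Longrightarrow> real_polynomial_function p"
    and sel: "selection P unit_square (permuton_cdf \<mu>)"
  shows "\<exists>N. \<forall>\<nu>. permuton \<nu> \<longrightarrow> densities_agree N \<mu> \<nu> \<longrightarrow> selection P unit_square (permuton_cdf \<nu>)"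
proof -
  \<comment> \<open>The square makes the integrand nonnegative, so by continuity a zero integral
    forces it to vanish everywhere.\<close>
  define f where "f w = (\<Prod>p\<in>P. snd w - (p \<circ> fst) w) ^ 2" for w :: "(real \<times> real) \<times> real"
  have "real_polynomial_function snd"
    by (intro real_polynomial_function.intros(1) bounded_linear_snd)
  moreover have "real_polynomial_function (p \<circ> fst)" if "p \<in> P" for p
    by (intro real_polynomial_function_compose assms(3) that polynomial_function_bounded_linear bounded_linear_fst)
  ultimately have "real_polynomial_function f"
    unfolding f_def[abs_def] using assms(2)
    by (intro real_polynomial_function_power real_polynomial_function_prod real_polynomial_function_diff)
  from polynomial_integral_forced[OF this] obtain N where N:
    "\<forall>\<mu> \<nu>. permuton \<mu> \<longrightarrow> permuton \<nu> \<longrightarrow> densities_agree N \<mu> \<nu> \<longrightarrow>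
      integral unit_square (\<lambda>z. f (z, permuton_cdf \<mu> z)) = integral unit_square (\<lambda>z. f (z, permuton_cdf \<nu> z))"
    by blast
  have zero: "f (z, permuton_cdf \<rho> z) = 0 \<longleftrightarrow> permuton_cdf \<rho> z \<in> (\<lambda>p. p z) ` P" for \<rho> z
    using assms(2) by (auto simp: f_def)
  show ?thesis
  proof (intro exI[of _ N] allI impI)
    fix \<nu> assume \<nu>: "permuton \<nu>" "densities_agree N \<mu> \<nu>"
    have "continuous_on unit_square p" if "p \<in> P" for p
      using assms(3)[OF that] by (intro continuous_on_polymonial_function) (simp add: real_polynomial_function_eq)
    then have cont: "continuous_on unit_square (\<lambda>z. f (z, permuton_cdf \<nu> z))"
      using continuous_on_permuton_cdf[OF \<nu>(1)] unfolding f_def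
      by (auto intro!: continuous_intros)
    have "integral unit_square (\<lambda>z. f (z, permuton_cdf \<nu> z)) = integral unit_square (\<lambda>z. f (z, permuton_cdf \<mu> z))"
      using N[rule_format, OF assms(1) \<nu>] by simp
    also have "\<dots> = integral unit_square (\<lambda>z. 0)"
      using sel zero by (intro Henstock_Kurzweil_Integration.integral_cong) (auto simp: selection_def)
    finally have "\<forall>z\<in>unit_square. f (z, permuton_cdf \<nu> z) = 0"
      using integral_unit_square_eq_0_iff[OF cont] by (simp add: f_def)
    then show "selection P unit_square (permuton_cdf \<nu>)"
      using continuous_on_permuton_cdf[OF \<nu>(1)] by (simp add: selection_def zero)
  qed
qed

theorem theorem5:
  fixes \<mu> :: "(real \<times> real) measure"
  assumes "permuton \<mu>"
    and "piecewise_polynomial (permuton_cdf \<mu>)"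
  shows "finitely_forcible \<mu>"
proof -
  obtain P where P: "finite P" "\<And>p. p \<in> P \<Longrightarrow> real_polynomial_function p"
    and "\<forall>z\<in>unit_square. permuton_cdf \<mu> z \<in> {p z | p. p \<in> P}"
    using assms(2) unfolding piecewise_polynomial_def by blast
  then have "selection P unit_square (permuton_cdf \<mu>)"
    using continuous_on_permuton_cdf[OF assms(1)] unfolding selection_def by blast
  from selection_forced[OF assms(1) P this] obtain N0 where N0:
    "\<forall>\<nu>. permuton \<nu> \<longrightarrow> densities_agree N0 \<mu> \<nu> \<longrightarrow> selection P unit_square (permuton_cdf \<nu>)"
    by blast
  \<comment> \<open>The rivals that agreement up to \<open>N0\<close> does not exclude; each gets
    its own separating order.\<close>
  define C where "C = {\<nu>. permuton \<nu> \<and> selection P unit_square (permuton_cdf \<nu>)} - {\<mu>}"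
  have "finite C" unfolding C_def using finitely_many_selection_permutons[OF P] by simp
  have "\<forall>\<nu>\<in>C. \<exists>N. \<not> densities_agree N \<mu> \<nu>"
    using permutons_separated[OF assms(1)] by (simp add: C_def)
  from bchoice[OF this] obtain K where K: "\<forall>\<nu>\<in>C. \<not> densities_agree (K \<nu>) \<mu> \<nu>" by blast
  \<comment> \<open>By monotonicity the largest of the finitely many bounds serves for all of
    them.\<close>
  define N where "N = Max (insert N0 (K ` C))"
  have mono: "densities_agree m \<mu> \<nu>" if "densities_agree N \<mu> \<nu>" "m \<in> insert N0 (K ` C)" for m \<nu>
  proof -
    have "m \<le> N" unfolding N_def using \<open>finite C\<close> that(2) by (intro Max_ge) auto
    then show ?thesis using that(1) unfolding densities_agree_def by simp
  qed
  define S where "S = (SIGMA n:{..N}. {\<pi>. \<pi> permutes {1..n}})"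
  show ?thesis
    unfolding finitely_forcible_def
  proof (intro exI[of _ S] conjI allI impI)
    show "finite S" unfolding S_def by (intro finite_SigmaI finite_permutations) auto
    show "S \<subseteq> finite_perms" by (auto simp: S_def finite_perms_def)
    fix \<nu> assume \<nu>: "permuton \<nu> \<and> (\<forall>\<sigma>\<in>S. perm_density \<sigma> \<nu> = perm_density \<sigma> \<mu>)"
    then have agree: "densities_agree N \<mu> \<nu>" by (auto simp: densities_agree_def S_def)
    show "\<nu> = \<mu>"
    proof (rule ccontr)
      assume "\<nu> \<noteq> \<mu>"
      then have "\<nu> \<in> C" using \<nu> N0 mono[OF agree] by (simp add: C_def)
      then show False using K mono[OF agree] by blast
    qed
  qed
qed

end
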